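(* Let $h>0$ be fixed, let $j=j(t)$ be a positive integer-valued function, and put $m:=\mathbb{E}\xi$. Assume that either (a) or (b) below holds: (a) the distribution of $\xi$ is nonlattice; for some $r$ either [$r\in(1,2]$ and $\mathbb{E}\xi^r<\infty$] or [$r\in(1,2)$ and $\mathbb{P}\{\xi>t\}\sim bt^{-r}$ as $t\to\infty$ for some $b>0$]; with the same $r$, $\mathbb{E}(\eta\wedge t)=O(t^{2-r})$ as $t\to\infty$; and $j(t)=o(t^{(r-1)/2})$ as $t\to\infty$; (b) the distribution of $\xi$ is spread-out, $\mathbb{E}\xi^3<\infty$, $\mathbb{E}\eta^2<\infty$, and $j(t)=o(t^{2/3})$ as $t\to\infty$. Then $$V_{j}(t+h)-V_{j}(t)\ \sim\ \frac{h}{m}\,V_{j-1}(t),\qquad t\to\infty,\quad j=j(t).$$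
   Context: Let $(\xi_i,\eta_i)_{i\in\mathbb{N}}$ be independent copies of a random vector $(\xi,\eta)$ whose components are almost surely positive and arbitrarily dependent. Put $S_0:=0$, $S_i:=\xi_1+\cdots+\xi_i$ and $T_i:=S_{i-1}+\eta_i$ for $i\in\mathbb{N}$ (a perturbed random walk). Let $N(t):=\sum_{i\ge1}\mathbf{1}_{\{T_i\le t\}}$ and $V(t):=\mathbb{E}N(t)$ for $t\ge0$, and $V(t):=0$ for $t<0$. Define $V_0:=\mathbf{1}_{[0,\infty)}$, $V_1:=V$ and, for $j\ge2$ and $t\ge0$, $V_j(t):=\int_{[0,t]}V_{j-1}(t-y)\,dV(y)$ (Lebesgue–Stieltjes integral), i.e. $V_j$ is the $j$-fold Lebesgue–Stieltjes convolution power of $V$. (Equivalently, for $j\ge1$, $V_j(t)$ is the expected number of $j$th generation individuals born in $[0,t]$ in the general branching process started by one ancestor at time $0$ in which each individual independently produces offspring at times, relative to its own birth, distributed as $(T_i)_{i\in\mathbb{N}}$.) The distribution of $\xi$ is nonlattice if it is not concentrated on any set $\{dn:n=0,1,2,\ldots\}$ with $d>0$. It is spread-out if some convolution power of the distribution function $t\mapsto\mathbb{P}\{\xi\le t\}$ has a (nontrivial) absolutely continuous component with respect to Lebesgue measure. Here $x\wedge y=\min(x,y)$, and $u(t)\sim v(t)$ means $u(t)/v(t)\to1$ as $t\to\infty$. *)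

theory Defs
  imports "HOL-Probability.Probability" "HOL-Library.Landau_Symbols"
begin

definition rw :: "(nat \<Rightarrow> 'a \<Rightarrow> real) \<Rightarrow> nat \<Rightarrow> 'a \<Rightarrow> real"
  where "rw \<xi>s i \<omega> = (\<Sum>k\<in>{1..i}. \<xi>s k \<omega>)"

text \<open>Only the indices \<open>i \<ge> 1\<close> of the sequences and of \<open>prw\<close> carry meaning.\<close>

definition prw :: "(nat \<Rightarrow> 'a \<Rightarrow> real) \<Rightarrow> (nat \<Rightarrow> 'a \<Rightarrow> real) \<Rightarrow> nat \<Rightarrow> 'a \<Rightarrow> real"
  where "prw \<xi>s \<eta>s i \<omega> = rw \<xi>s (i - 1) \<omega> + \<eta>s i \<omega>"

definition prw_count :: "(nat \<Rightarrow> 'a \<Rightarrow> real) \<Rightarrow> (nat \<Rightarrow> 'a \<Rightarrow> real) \<Rightarrow> real \<Rightarrow> 'a \<Rightarrow> ennreal"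
  where "prw_count \<xi>s \<eta>s t \<omega> = (\<Sum>i. indicator {..t} (prw \<xi>s \<eta>s (Suc i) \<omega>))"

text \<open>The expectation is taken in \<open>[0,\<infinity>]\<close> and then read as a real number. For almost surely
  positive i.i.d. steps it is finite, being bounded by the renewal function of the walk, so the
  convention that \<open>enn2real\<close> sends \<open>\<infinity>\<close> to \<open>0\<close> plays no role.\<close>

definition prw_V :: "'a measure \<Rightarrow> (nat \<Rightarrow> 'a \<Rightarrow> real) \<Rightarrow> (nat \<Rightarrow> 'a \<Rightarrow> real) \<Rightarrow> real \<Rightarrow> real"
  where "prw_V M \<xi>s \<eta>s t =
    (if t < 0 then 0 else enn2real (\<integral>\<^sup>+\<omega>. prw_count \<xi>s \<eta>s t \<omega> \<partial>M))"

text \<open>For nondecreasing right-continuous \<open>F\<close>, \<open>interval_measure F\<close> is the Lebesgue-Stieltjes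
  measure of \<open>F\<close>. If moreover \<open>F\<close> vanishes on the negative half-line, it gives \<open>{0}\<close> the mass
  \<open>F 0\<close>, as integration over the closed interval \<open>[0,t]\<close> requires. For \<open>t < 0\<close> the interval is
  empty and the powers vanish.\<close>

fun ls_conv_power :: "(real \<Rightarrow> real) \<Rightarrow> nat \<Rightarrow> real \<Rightarrow> real" where
  "ls_conv_power F 0 t = indicator {0..} t"
| "ls_conv_power F (Suc 0) t = F t"
| "ls_conv_power F (Suc (Suc n)) t =
     (LINT y:{0..t}|interval_measure F. ls_conv_power F (Suc n) (t - y))"

definition nonlattice :: "real measure \<Rightarrow> bool"
  where "nonlattice \<mu> \<longleftrightarrow> \<not> (\<exists>d>0. AE x in \<mu>. x \<in> range (\<lambda>n::nat. d * real n))"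

primrec measure_conv_power :: "real measure \<Rightarrow> nat \<Rightarrow> real measure" where
  "measure_conv_power \<mu> 0 = return borel 0"
| "measure_conv_power \<mu> (Suc n) = convolution \<mu> (measure_conv_power \<mu> n)"

text \<open>The absolutely continuous part in the Lebesgue decomposition \<open>\<nu> = \<alpha> + \<sigma>\<close> with respect to
  Lebesgue measure, \<open>\<sigma>\<close> being singular, is nonzero.\<close>

definition has_ac_component :: "real measure \<Rightarrow> bool"
  where "has_ac_component \<nu> \<longleftrightarrow>
    (\<exists>\<alpha> \<sigma>. sets \<alpha> = sets borel \<and> sets \<sigma> = sets borel \<and>
      (\<forall>A\<in>sets borel. emeasure \<nu> A = emeasure \<alpha> A + emeasure \<sigma> A) \<and>
      absolutely_continuous lborel \<alpha> \<and>
      (\<exists>Z\<in>null_sets lborel. emeasure \<sigma> (UNIV - Z) = 0) \<and>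
      emeasure \<alpha> UNIV \<noteq> 0)"

definition spread_out :: "real measure \<Rightarrow> bool"
  where "spread_out \<mu> \<longleftrightarrow> (\<exists>n\<ge>1. has_ac_component (measure_conv_power \<mu> n))"

end

theory Submission
  imports Defs
begin

text \<open>
  Write \<open>\<nu>\<close> for the Lebesgue-Stieltjes measure of \<open>V\<close> and \<open>\<nu> \<odot> f\<close> for the function
  \<open>t \<mapsto> \<integral> f (t - y) \<nu>(dy)\<close>. Then \<open>V_n\<close> is the \<open>n\<close>-th iterate of \<open>\<nu> \<odot> _\<close> on the indicator of
  \<open>[0, \<infinity>)\<close>. The iterates are additive, monotone and commute with shifts, so \<open>V_j (t + h) - V_j t\<close> is
  the \<open>(j - 1)\<close>-th iterate of the increment \<open>x \<mapsto> V (x + h) - V x\<close>. This increment is bounded and, by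
  Blackwell's renewal theorem, tends to \<open>h / m\<close>. It follows that \<open>V_j (t + h) - V_j t\<close> equals
  \<open>(h / m + o(1)) V_{j-1} t\<close> up to a multiple of \<open>V_{j-1} (t + h) - V_{j-1} (t - a)\<close> for a constant
  \<open>a\<close>, and it remains to see that \<open>V_{j-1}\<close> hardly changes over bounded distances.

  Since \<open>V\<close> has bounded increments, an increment of \<open>V_{n+1}\<close> is at most a constant times \<open>V_n\<close>, so
  slow variation reduces to \<open>V_n t / V_{n+1} t \<rightarrow> 0\<close>, uniformly in \<open>n \<le> j(t)\<close>. Regard \<open>V_n t\<close> as the
  \<open>\<nu>\<close>-volume of the simplex of all \<open>(y_1, ..., y_n)\<close> with sum at most \<open>t\<close>. The ratio
  \<open>V_{n+1} t / V_n t\<close> is the average of \<open>V\<close> over the slack \<open>t - y_1 - ... - y_n\<close>, and \<open>V\<close> grows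
  linearly. By symmetry all coordinates have the same average, and linear growth of \<open>V\<close> makes the
  average slack at least a fixed fraction of it, up to a constant. As the coordinates and the slack
  add up to \<open>t\<close>, the average slack is at least of order \<open>t / n\<close>, and so is the ratio
  (\<open>power_ratio\<close>). It tends to infinity because \<open>j(t) = o(t)\<close> in both cases of the theorem;
  \<open>power_increment\<close> combines these facts.

  Blackwell's theorem is proved along the lines of Feller. For a Lipschitz function \<open>z\<close> of compact
  support the renewal equation says that \<open>Z = \<Sum>n. \<mu>^n \<odot> z\<close> is, far out, an average of its own
  shifts with respect to the step law \<open>\<mu>\<close>. If an increment of \<open>Z\<close> is close to its upper limit at
  \<open>t\<close>, it must be so at \<open>t - a\<close> for every \<open>a\<close> in the semigroup generated by the support of \<open>\<mu>\<close>.
  In the nonlattice case this semigroup is eventually dense, and boundedness of \<open>Z\<close> forces the upper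
  limit to be at most \<open>0\<close> (\<open>harmonic_increment_limsup\<close>); applied to \<open>Z\<close> and \<open>- Z\<close>, this shows that
  the increments of \<open>Z\<close> vanish in the limit. The limit of \<open>Z\<close> is then read off from the identity
  \<open>\<Sum>n. \<mu>^n \<odot> tail = 1\<close> on \<open>[0, \<infinity>)\<close>, where \<open>tail x = \<mu>{y > x}\<close> has integral \<open>m\<close>. The perturbation
  \<open>\<eta>\<close> merely averages the renewal function over the law of \<open>\<eta>\<close>, which does not affect the limit of
  the increments.
\<close>

section \<open>Convolution operators on nonnegative functions\<close>

text \<open>Working with functions into \<open>[0, \<infinity>]\<close> makes the interchange of sums and integrals
  free of integrability conditions, also for measures of infinite mass such as that of \<open>V\<close>.\<close>

definition conv_fun :: "real measure \<Rightarrow> (real \<Rightarrow> ennreal) \<Rightarrow> real \<Rightarrow> ennreal"  (infixr \<open>\<odot>\<close> 75)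
  where "(\<mu> \<odot> f) t = (\<integral>\<^sup>+y. f (t - y) \<partial>\<mu>)"

abbreviation conv_iter :: "real measure \<Rightarrow> nat \<Rightarrow> (real \<Rightarrow> ennreal) \<Rightarrow> real \<Rightarrow> ennreal"
  where "conv_iter \<mu> n \<equiv> (\<odot>) \<mu> ^^ n"

lemma conv_iter_Suc: "conv_iter \<mu> (Suc n) f t = (\<integral>\<^sup>+y. conv_iter \<mu> n f (t - y) \<partial>\<mu>)"
  by (simp add: conv_fun_def)

abbreviation heaviside :: "real \<Rightarrow> ennreal"
  where "heaviside \<equiv> indicator {0..}"

locale sigma_finite_borel = sigma_finite_measure \<mu> for \<mu> :: "real measure" +
  assumes sets_eq_borel [measurable_cong, simp]: "sets \<mu> = sets borel"
begin

lemma space_eq_UNIV [simp]: "space \<mu> = UNIV"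
  using sets_eq_imp_space_eq[OF sets_eq_borel] by simp

lemma conv_measurable [measurable]:
  assumes [measurable]: "f \<in> borel_measurable borel"
  shows "\<mu> \<odot> f \<in> borel_measurable borel"
  unfolding conv_fun_def by measurable

lemma conv_iter_measurable [measurable]:
  assumes [measurable]: "f \<in> borel_measurable borel"
  shows "conv_iter \<mu> n f \<in> borel_measurable borel"
  by (induction n) auto

lemma conv_add:
  assumes [measurable]: "f \<in> borel_measurable borel" "g \<in> borel_measurable borel"
  shows "\<mu> \<odot> (\<lambda>x. f x + g x) = (\<lambda>x. (\<mu> \<odot> f) x + (\<mu> \<odot> g) x)"
  by (auto simp: conv_fun_def fun_eq_iff intro!: nn_integral_add)

lemma conv_cmult:
  assumes [measurable]: "f \<in> borel_measurable borel"
  shows "\<mu> \<odot> (\<lambda>x. c * f x) = (\<lambda>x. c * (\<mu> \<odot> f) x)"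
  by (auto simp: conv_fun_def fun_eq_iff intro!: nn_integral_cmult)

lemma conv_shift: "\<mu> \<odot> (\<lambda>x. f (x + s)) = (\<lambda>x. (\<mu> \<odot> f) (x + s))"
  by (auto simp: conv_fun_def fun_eq_iff algebra_simps)

lemma conv_suminf:
  assumes [measurable]: "\<And>n. f n \<in> borel_measurable borel"
  shows "\<mu> \<odot> (\<lambda>x. \<Sum>n. f n x) = (\<lambda>x. \<Sum>n. (\<mu> \<odot> f n) x)"
  by (auto simp: conv_fun_def fun_eq_iff intro!: nn_integral_suminf)

lemma conv_iter_add:
  assumes [measurable]: "f \<in> borel_measurable borel" "g \<in> borel_measurable borel"
  shows "conv_iter \<mu> n (\<lambda>x. f x + g x) = (\<lambda>x. conv_iter \<mu> n f x + conv_iter \<mu> n g x)"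
  by (induction n) (auto simp: conv_add)

lemma conv_iter_cmult:
  assumes [measurable]: "f \<in> borel_measurable borel"
  shows "conv_iter \<mu> n (\<lambda>x. c * f x) = (\<lambda>x. c * conv_iter \<mu> n f x)"
  by (induction n) (auto simp: conv_cmult)

lemma conv_iter_shift: "conv_iter \<mu> n (\<lambda>x. f (x + s)) = (\<lambda>x. conv_iter \<mu> n f (x + s))"
  by (induction n) (auto simp: conv_shift)

lemma conv_heaviside: "(\<mu> \<odot> heaviside) t = emeasure \<mu> {..t}"
proof -
  have "(\<mu> \<odot> heaviside) t = (\<integral>\<^sup>+y. indicator {..t} y \<partial>\<mu>)"
    unfolding conv_fun_def by (intro nn_integral_cong) (auto split: split_indicator)
  then show ?thesis by simp
qed

end

lemma conv_commute:
  assumes "sigma_finite_borel \<mu>" "sigma_finite_borel \<nu>"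
    and [measurable]: "f \<in> borel_measurable borel"
  shows "\<mu> \<odot> (\<nu> \<odot> f) = \<nu> \<odot> (\<mu> \<odot> f)"
proof
  interpret \<mu>: sigma_finite_borel \<mu> by fact
  interpret \<nu>: sigma_finite_borel \<nu> by fact
  interpret pair_sigma_finite \<mu> \<nu> ..
  fix t
  have "(\<mu> \<odot> (\<nu> \<odot> f)) t = (\<integral>\<^sup>+x. \<integral>\<^sup>+y. f (t - x - y) \<partial>\<nu> \<partial>\<mu>)"
    by (simp add: conv_fun_def)
  also have "\<dots> = (\<integral>\<^sup>+y. \<integral>\<^sup>+x. f (t - x - y) \<partial>\<mu> \<partial>\<nu>)"
    by (rule Fubini'[symmetric]) simp
  also have "\<dots> = (\<nu> \<odot> (\<mu> \<odot> f)) t"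
    by (simp add: conv_fun_def algebra_simps)
  finally show "(\<mu> \<odot> (\<nu> \<odot> f)) t = (\<nu> \<odot> (\<mu> \<odot> f)) t" .
qed

lemma conv_iter_commute:
  assumes "sigma_finite_borel \<mu>" "sigma_finite_borel \<nu>"
    and [measurable]: "f \<in> borel_measurable borel"
  shows "\<nu> \<odot> conv_iter \<mu> n f = conv_iter \<mu> n (\<nu> \<odot> f)"
proof (induction n)
  case (Suc n)
  interpret \<mu>: sigma_finite_borel \<mu> by fact
  show ?case
    using conv_commute[OF assms(2,1), of "conv_iter \<mu> n f"] Suc by simp
qed simp

text \<open>A measure carried by the half-line acts causally: the value at \<open>t\<close> only depends on
  the values of the argument on \<open>{..t}\<close>.\<close>

locale halfline_measure = sigma_finite_borel +
  assumes AE_nonneg: "AE y in \<mu>. 0 \<le> y"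
begin

lemma conv_causal_mono:
  assumes "\<And>x. x \<le> t \<Longrightarrow> f x \<le> g x"
  shows "(\<mu> \<odot> f) t \<le> (\<mu> \<odot> g) t"
  unfolding conv_fun_def
  by (intro nn_integral_mono_AE AE_mp[OF AE_nonneg AE_I2]) (auto intro: assms)

lemma conv_iter_causal_mono:
  assumes "\<And>x. x \<le> t \<Longrightarrow> f x \<le> g x"
  shows "conv_iter \<mu> n f t \<le> conv_iter \<mu> n g t"
  using assms
proof (induction n arbitrary: t)
  case (Suc n)
  then show ?case by (auto intro!: conv_causal_mono)
qed auto

lemma conv_iter_causal_cong:
  assumes "\<And>x. x \<le> t \<Longrightarrow> f x = g x"
  shows "conv_iter \<mu> n f t = conv_iter \<mu> n g t"
  by (intro antisym conv_iter_causal_mono) (auto simp: assms)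

lemma conv_iter_eq_0:
  assumes "\<And>x. x \<le> t \<Longrightarrow> f x = 0"
  shows "conv_iter \<mu> n f t = 0"
proof -
  have "conv_iter \<mu> n (\<lambda>_. 0) t = 0"
    by (induction n arbitrary: t) (auto simp: conv_fun_def)
  then show ?thesis
    using conv_iter_causal_cong[of t f "\<lambda>_. 0"] assms by simp
qed

end

section \<open>The renewal operator\<close>

definition renewal :: "real measure \<Rightarrow> (real \<Rightarrow> ennreal) \<Rightarrow> real \<Rightarrow> ennreal"
  where "renewal \<mu> f t = (\<Sum>n. conv_iter \<mu> n f t)"

locale renewal_law = prob_space \<mu> for \<mu> :: "real measure" +
  assumes sets_borel: "sets \<mu> = sets borel"
    and AE_pos: "AE y in \<mu>. 0 < y"

sublocale renewal_law \<subseteq> halfline_measure \<mu>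
  by unfold_locales (use AE_pos sets_borel in auto)

context renewal_law
begin

lemma renewal_measurable [measurable]:
  assumes [measurable]: "f \<in> borel_measurable borel"
  shows "renewal \<mu> f \<in> borel_measurable borel"
  unfolding renewal_def by measurable

lemma renewal_add:
  assumes [measurable]: "f \<in> borel_measurable borel" "g \<in> borel_measurable borel"
  shows "renewal \<mu> (\<lambda>x. f x + g x) t = renewal \<mu> f t + renewal \<mu> g t"
  by (simp add: renewal_def conv_iter_add suminf_add)

lemma renewal_cmult:
  assumes [measurable]: "f \<in> borel_measurable borel"
  shows "renewal \<mu> (\<lambda>x. c * f x) t = c * renewal \<mu> f t"
  by (simp add: renewal_def conv_iter_cmult)

lemma renewal_shift: "renewal \<mu> (\<lambda>x. f (x + s)) t = renewal \<mu> f (t + s)"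
  by (simp add: renewal_def conv_iter_shift)

lemma renewal_causal_mono:
  assumes "\<And>x. x \<le> t \<Longrightarrow> f x \<le> g x"
  shows "renewal \<mu> f t \<le> renewal \<mu> g t"
  unfolding renewal_def by (intro suminf_le conv_iter_causal_mono assms) auto

lemma renewal_causal_cong:
  assumes "\<And>x. x \<le> t \<Longrightarrow> f x = g x"
  shows "renewal \<mu> f t = renewal \<mu> g t"
  by (intro antisym renewal_causal_mono) (auto simp: assms)

lemma renewal_sum:
  assumes [measurable]: "\<And>i. i \<in> I \<Longrightarrow> f i \<in> borel_measurable borel" and "finite I"
  shows "renewal \<mu> (\<lambda>x. \<Sum>i\<in>I. f i x) t = (\<Sum>i\<in>I. renewal \<mu> (f i) t)"
  using assms(2,1)
proof (induction I rule: finite_induct)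
  case empty
  show ?case by (simp add: renewal_def conv_iter_eq_0)
next
  case (insert i I)
  then have [measurable]: "f i \<in> borel_measurable borel" "(\<lambda>x. \<Sum>i\<in>I. f i x) \<in> borel_measurable borel"
    by auto
  show ?case using insert by (simp add: renewal_add)
qed

lemma renewal_commute:
  assumes "sigma_finite_borel \<nu>" and [measurable]: "f \<in> borel_measurable borel"
  shows "\<nu> \<odot> renewal \<mu> f = renewal \<mu> (\<nu> \<odot> f)"
proof -
  interpret \<nu>: sigma_finite_borel \<nu> by fact
  have "\<nu> \<odot> (\<lambda>x. \<Sum>n. conv_iter \<mu> n f x) = (\<lambda>x. \<Sum>n. (\<nu> \<odot> conv_iter \<mu> n f) x)"
    by (rule \<nu>.conv_suminf) simp
  also have "\<dots> = (\<lambda>x. \<Sum>n. conv_iter \<mu> n (\<nu> \<odot> f) x)"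
    using conv_iter_commute[OF sigma_finite_borel_axioms assms(1), of f] by simp
  finally show ?thesis
    by (simp add: renewal_def[abs_def])
qed

text \<open>Separating the first summand of the series gives the renewal equation.\<close>

lemma renewal_equation:
  assumes [measurable]: "f \<in> borel_measurable borel"
  shows "renewal \<mu> f t = f t + (\<mu> \<odot> renewal \<mu> f) t"
proof -
  have "renewal \<mu> f t = conv_iter \<mu> 0 f t + (\<Sum>n. conv_iter \<mu> (Suc n) f t)"
    unfolding renewal_def by (rule sums_unique[symmetric], subst add.commute, rule sums_Suc, rule summable_sums) auto
  also have "(\<Sum>n. conv_iter \<mu> (Suc n) f t) = (\<mu> \<odot> renewal \<mu> f) t"
    using fun_cong[OF conv_suminf[of "\<lambda>n. conv_iter \<mu> n f"], of t]
    by (simp add: renewal_def[abs_def])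
  finally show ?thesis by simp
qed

text \<open>The tail function \<open>x \<mapsto> \<mu>{y > x}\<close> of the step law: since it equals
  \<open>heaviside - \<mu> \<odot> heaviside\<close>, the renewal operator inverts it to \<open>heaviside\<close> by telescoping.
  This single identity yields both the local boundedness of the renewal function and the value
  of the limit in Blackwell's theorem.\<close>

definition tail :: "real \<Rightarrow> ennreal"
  where "tail x = indicator {0..} x * emeasure \<mu> {x<..}"

lemma tail_measurable [measurable]: "tail \<in> borel_measurable borel"
proof -
  have "emeasure \<mu> {x<..} = (\<mu> \<odot> indicator {..<0}) x" for x
  proof -
    have "(\<mu> \<odot> indicator {..<0}) x = (\<integral>\<^sup>+y. indicator {x<..} y \<partial>\<mu>)"
      unfolding conv_fun_def by (intro nn_integral_cong) (auto split: split_indicator)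
    then show ?thesis by simp
  qed
  then show ?thesis unfolding tail_def[abs_def] by simp
qed

lemma tail_telescope: "tail x + (\<mu> \<odot> heaviside) x = heaviside x"
proof (cases "0 \<le> x")
  case True
  have "emeasure \<mu> {x<..} + emeasure \<mu> {..x} = emeasure \<mu> ({x<..} \<union> {..x})"
    by (rule plus_emeasure) auto
  also have "{x<..} \<union> {..x} = UNIV" by auto
  finally show ?thesis
    using True emeasure_space_1 by (simp add: tail_def conv_heaviside)
next
  case False
  have "conv_iter \<mu> 1 heaviside x = 0"
    by (rule conv_iter_eq_0) (use False in auto)
  then show ?thesis using False by (simp add: tail_def)
qed

text \<open>Applying the \<open>n\<close>-th iterate to \<open>tail_telescope\<close> gives the \<open>n\<close>-th term of a telescoping
  sum.\<close>

lemma tail_partial_sums: "(\<Sum>n<N. conv_iter \<mu> n tail t) + conv_iter \<mu> N heaviside t = heaviside t"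
proof (induction N)
  case (Suc N)
  have "conv_iter \<mu> N (\<lambda>x. tail x + (\<mu> \<odot> heaviside) x) t = conv_iter \<mu> N heaviside t"
    by (simp only: tail_telescope)
  then have "conv_iter \<mu> N tail t + conv_iter \<mu> (Suc N) heaviside t = conv_iter \<mu> N heaviside t"
    by (simp add: conv_iter_add conv_iter_commute[OF sigma_finite_borel_axioms sigma_finite_borel_axioms])
  then show ?case using Suc by (simp add: add.assoc)
qed simp

lemma renewal_tail_le: "renewal \<mu> tail t \<le> heaviside t"
  unfolding renewal_def
proof (rule suminf_le_const)
  show "(\<Sum>n<N. conv_iter \<mu> n tail t) \<le> heaviside t" for N
    using tail_partial_sums[of t N] by (metis le_iff_add)
qed simp

lemma obtain_tail_pos: obtains a where "a > 0" "emeasure \<mu> {a<..} > 0"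
proof -
  have "\<exists>n::nat. emeasure \<mu> {inverse (real (Suc n))<..} > 0"
  proof (rule ccontr)
    assume "\<not> ?thesis"
    then have "emeasure \<mu> {inverse (real (Suc n))<..} = 0" for n
      by auto
    then have "AE y in \<mu>. \<forall>n. \<not> inverse (real (Suc n)) < y"
      unfolding AE_all_countable
      by (intro allI AE_I'[of "{inverse (real (Suc _))<..}"]) (auto simp: null_sets_def)
    with AE_pos have "AE y in \<mu>. False"
      by eventually_elim (meson reals_Archimedean)
    then show False by simp
  qed
  then show ?thesis using that by (metis inverse_positive_iff_positive of_nat_0_less_iff zero_less_Suc)
qed

text \<open>The tail is bounded below on \<open>{0..a}\<close> for some \<open>a > 0\<close>, so \<open>renewal_tail_le\<close> bounds the
  expected number of renewals in any interval of length \<open>a\<close>; longer intervals are covered by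
  finitely many of these.\<close>

lemma renewal_interval_bounded: "\<exists>C<\<infinity>. \<forall>c t. renewal \<mu> (indicator {c..c + b}) t \<le> C"
proof -
  obtain a where a: "a > 0" "emeasure \<mu> {a<..} > 0" by (rule obtain_tail_pos)
  define q where "q = emeasure \<mu> {a<..}"
  have q: "q > 0" "q < \<infinity>" using a by (auto simp: q_def less_top[symmetric])
  have 1: "renewal \<mu> (indicator {c..c + a}) t \<le> 1 / q" for c t
  proof -
    have "q * indicator {0..a} x \<le> tail x" for x
      by (auto simp: tail_def q_def split: split_indicator intro!: emeasure_mono)
    then have "q * renewal \<mu> (indicator {0..a}) s \<le> renewal \<mu> tail s" for s
      by (subst renewal_cmult[symmetric]) (auto intro!: renewal_causal_mono)
    also have "renewal \<mu> tail s \<le> 1" for s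
      by (rule order.trans[OF renewal_tail_le]) (auto split: split_indicator)
    finally have 2: "q * renewal \<mu> (indicator {0..a}) s \<le> 1" for s .
    have "renewal \<mu> (indicator {0..a}) s \<le> 1 / q" for s
    proof -
      have "renewal \<mu> (indicator {0..a}) s = (renewal \<mu> (indicator {0..a}) s * q) / q"
        by (rule mult_divide_eq_ennreal[symmetric]) (use q in auto)
      also have "\<dots> \<le> 1 / q"
        using 2 by (intro divide_right_mono_ennreal) (simp add: mult.commute)
      finally show ?thesis .
    qed
    moreover have "renewal \<mu> (indicator {c..c + a}) t = renewal \<mu> (indicator {0..a}) (t + - c)"
      by (subst renewal_shift[symmetric], intro renewal_causal_cong) (auto split: split_indicator)
    ultimately show ?thesis by simp
  qed
  obtain n :: nat where "b < real n * a"
    using reals_Archimedean3[OF a(1)] by blast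
  then obtain N :: nat where N: "b \<le> real N * a" "N > 0"
    using a by (intro that[of "Suc n"]) (auto simp: algebra_simps)
  have 2: "renewal \<mu> (indicator {c..c + b}) t \<le> of_nat N * (1 / q)" for c t
  proof -
    have "indicator {c..c+b} x \<le> (\<Sum>i<N. indicator {c + real i * a..c + real i * a + a} x :: ennreal)" for x
    proof (cases "x \<in> {c..c+b} \<and> x < c + real N * a")
      case True
      \<comment> \<open>The index of the cell of length \<open>a\<close> that contains \<open>x\<close>.\<close>
      define k where "k = nat \<lfloor>(x - c) / a\<rfloor>"
      have "0 \<le> (x - c) / a" "(x - c) / a < real N" using True a by (auto simp: field_simps)
      then have k: "k < N" "real k \<le> (x - c) / a" "(x - c) / a < real k + 1"
        unfolding k_def by linarith+
      have "(1::ennreal) = indicator {c + real k * a..c + real k * a + a} x"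
        using k a by (auto simp: field_simps split: split_indicator)
      also have "\<dots> \<le> (\<Sum>i<N. indicator {c + real i * a..c + real i * a + a} x)"
        using k by (intro member_le_sum) auto
      finally show ?thesis by (auto split: split_indicator)
    next
      case False
      show ?thesis
      proof (cases "x \<in> {c..c+b}")
        case True
        \<comment> \<open>The right end point of the last cell, which rounding down would assign to cell \<open>N\<close>.\<close>
        then have x: "x = c + real N * a" using False N by auto
        have *: "real (N - 1) = real N - 1" using N(2) by simp
        have "(1::ennreal) = indicator {c + real (N - 1) * a..c + real (N - 1) * a + a} x"
          unfolding x * using a by (auto simp: field_simps split: split_indicator)
        also have "\<dots> \<le> (\<Sum>i<N. indicator {c + real i * a..c + real i * a + a} x)"
          using N by (intro member_le_sum) auto
        finally show ?thesis by (auto split: split_indicator)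
      qed auto
    qed
    then have "renewal \<mu> (indicator {c..c+b}) t \<le>
        renewal \<mu> (\<lambda>x. \<Sum>i<N. indicator {c + real i * a..c + real i * a + a} x) t"
      by (intro renewal_causal_mono) auto
    also have "\<dots> = (\<Sum>i<N. renewal \<mu> (indicator {c + real i * a..c + real i * a + a}) t)"
      by (intro renewal_sum) auto
    also have "\<dots> \<le> (\<Sum>i<N. 1 / q)"
      by (intro sum_mono 1)
    finally show ?thesis by simp
  qed
  have "of_nat N * (1 / q) < \<infinity>"
    using q by (auto simp: ennreal_mult_eq_top_iff ennreal_divide_eq_top_iff less_top[symmetric])
  with 2 show ?thesis by blast
qed

lemma renewal_heaviside_finite: "renewal \<mu> heaviside t < \<infinity>"
proof -
  obtain C where C: "C < \<infinity>" "renewal \<mu> (indicator {0..0 + t}) t \<le> C"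
    using renewal_interval_bounded[of t] by blast
  have "renewal \<mu> heaviside t = renewal \<mu> (indicator {0..0 + t}) t"
    by (intro renewal_causal_cong) (auto split: split_indicator)
  then show ?thesis using C by auto
qed

text \<open>The remainder of the telescoping sum vanishes, being the general term of the convergent
  series \<open>renewal \<mu> heaviside t\<close>.\<close>

lemma renewal_tail: "renewal \<mu> tail t = heaviside t"
proof -
  have "(\<lambda>N. conv_iter \<mu> N heaviside t) \<longlonglongrightarrow> 0"
  proof -
    define r where "r n = enn2real (conv_iter \<mu> n heaviside t)" for n
    have fin: "conv_iter \<mu> n heaviside t < \<infinity>" for n
      using renewal_heaviside_finite[of t] unfolding renewal_def
      by (metis infinity_ennreal_def ennreal_suminf_lessD)
    have r: "ennreal (r n) = conv_iter \<mu> n heaviside t" for n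
      using fin by (simp add: r_def)
    have "summable r"
      by (rule summable_suminf_not_top)
        (use renewal_heaviside_finite[of t] in \<open>auto simp: r renewal_def, simp add: r_def\<close>)
    then have "(\<lambda>n. ennreal (r n)) \<longlonglongrightarrow> ennreal 0"
      by (intro tendsto_ennrealI summable_LIMSEQ_zero)
    then show ?thesis by (simp add: r)
  qed
  moreover have "(\<lambda>N. \<Sum>n<N. conv_iter \<mu> n tail t) \<longlonglongrightarrow> renewal \<mu> tail t"
    unfolding renewal_def by (intro summable_LIMSEQ) auto
  ultimately have "(\<lambda>N. (\<Sum>n<N. conv_iter \<mu> n tail t) + conv_iter \<mu> N heaviside t)
      \<longlonglongrightarrow> renewal \<mu> tail t + 0"
    by (intro tendsto_add)
  then show ?thesis
    by (simp add: tail_partial_sums LIMSEQ_const_iff)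
qed

end

section \<open>Asymptotically harmonic functions\<close>

text \<open>For an additive semigroup of reals either the differences of its elements stay away from \<open>0\<close>,
  which forces a lattice, or some \<open>s\<close> and \<open>s + u\<close> with small \<open>u > 0\<close> belong to it; then so do
  \<open>n * s + k * u\<close> for \<open>k \<le> n\<close>, and these points leave no gap of length \<open>u\<close> far out.\<close>

lemma additive_semigroup_dichotomy:
  fixes S :: "real set"
  assumes add: "\<And>a b. a \<in> S \<Longrightarrow> b \<in> S \<Longrightarrow> a + b \<in> S" and p: "p \<in> S" "p > 0"
  obtains (lattice) d where "d > 0" "\<And>x. x \<in> S \<Longrightarrow> \<exists>k::int. x = d * of_int k"
  | (dense) "\<And>\<delta>. \<delta> > 0 \<Longrightarrow> \<exists>A. \<forall>x\<ge>A. \<exists>s\<in>S. \<bar>x - s\<bar> < \<delta>"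
proof (cases "\<forall>\<delta>>0. \<exists>a\<in>S. \<exists>b\<in>S. 0 < b - a \<and> b - a < \<delta>")
  case True
  have mult: "real n * x \<in> S" if "x \<in> S" "n \<ge> 1" for n x
    using that(2)
  proof (induction n rule: dec_induct)
    case (step n)
    then show ?case using add[OF step.IH that(1)] by (simp add: algebra_simps)
  qed (use that in simp)
  show ?thesis
  proof (rule dense)
    fix \<delta> :: real assume "\<delta> > 0"
    then obtain a b where ab: "a \<in> S" "b \<in> S" "0 < b - a" "b - a < \<delta>"
      using True by blast
    define u where "u = b - a"
    obtain K :: nat where K: "- a < real K * p"
      using reals_Archimedean3[OF p(2)] by blast
    \<comment> \<open>Both points are moved by the same multiple of \<open>p\<close> to make them positive.\<close>
    define s where "s = a + real (Suc K) * p"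
    have s: "s > 0" "s \<in> S" "s + u \<in> S"
      using K p ab add[OF ab(1) mult[OF p(1), of "Suc K"]] add[OF ab(2) mult[OF p(1), of "Suc K"]]
      by (auto simp: s_def u_def algebra_simps)
    have u: "u > 0" "u < \<delta>" using ab by (auto simp: u_def)
    have grid: "real n * s + real k * u \<in> S" if "k \<le> n" "n \<ge> 1" for n k
    proof -
      consider "k = 0" | "k = n" | "1 \<le> k" "1 \<le> n - k" using \<open>k \<le> n\<close> by linarith
      then show ?thesis
      proof cases
        case 3
        have "real (n - k) * s + real k * (s + u) \<in> S"
          by (rule add[OF mult[OF s(2) 3(2)] mult[OF s(3) 3(1)]])
        also have "real (n - k) * s + real k * (s + u) = real n * s + real k * u"
          using \<open>k \<le> n\<close> by (simp add: of_nat_diff algebra_simps)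
        finally show ?thesis .
      next
        case 2
        then show ?thesis using mult[OF s(3), of n] that by (simp add: algebra_simps)
      qed (use mult[OF s(2), of n] that in simp)
    qed
    \<comment> \<open>From \<open>n0\<close> on, the grid starting at \<open>n * s\<close> reaches beyond \<open>(n + 1) * s\<close>.\<close>
    obtain n0 :: nat where n0: "s < real n0 * u"
      using reals_Archimedean3[OF u(1)] by blast
    show "\<exists>A. \<forall>x\<ge>A. \<exists>s\<in>S. \<bar>x - s\<bar> < \<delta>"
    proof (intro exI[of _ "real (Suc n0) * s"] allI impI)
      fix x assume x: "real (Suc n0) * s \<le> x"
      define n where "n = nat \<lfloor>x / s\<rfloor>"
      have "real (Suc n0) \<le> x / s" using x s by (simp add: field_simps)
      then have n: "Suc n0 \<le> n" "real n \<le> x / s" "x / s < real n + 1"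
        unfolding n_def by linarith+
      define r where "r = x - real n * s"
      have r: "0 \<le> r" "r < s" using n s by (auto simp: r_def field_simps)
      define k where "k = nat \<lfloor>r / u\<rfloor>"
      have "0 \<le> r / u" using r u by simp
      then have k: "real k \<le> r / u" "r / u < real k + 1"
        unfolding k_def by linarith+
      then have k': "real k * u \<le> r" "r < real k * u + u" using u by (auto simp: field_simps)
      have "real k * u < real n0 * u" using k' r n0 by linarith
      then have "k \<le> n" using u n by simp
      then have "real n * s + real k * u \<in> S" using n by (intro grid) auto
      moreover have "\<bar>x - (real n * s + real k * u)\<bar> < \<delta>"
        using k' u unfolding r_def by linarith
      ultimately show "\<exists>s\<in>S. \<bar>x - s\<bar> < \<delta>" by blast
    qed
  qed
next
  case False
  then obtain \<delta> where \<delta>: "\<delta> > 0" "\<And>a b. a \<in> S \<Longrightarrow> b \<in> S \<Longrightarrow> 0 < b - a \<Longrightarrow> \<delta> \<le> b - a"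
    by (metis linorder_not_le)
  define G where "G = {b - a |a b. a \<in> S \<and> b \<in> S}"
  have G_diff: "x - y \<in> G" if "x \<in> G" "y \<in> G" for x y
  proof -
    obtain a b a' b' where *: "a \<in> S" "b \<in> S" "a' \<in> S" "b' \<in> S" "x = b - a" "y = b' - a'"
      using \<open>x \<in> G\<close> \<open>y \<in> G\<close> unfolding G_def by blast
    have "x - y = (b + a') - (a + b')" using * by simp
    then show ?thesis unfolding G_def using add * by blast
  qed
  have S_G: "x \<in> G" if "x \<in> S" for x
  proof -
    have "x = (x + x) - x" by simp
    then show ?thesis unfolding G_def using that add[OF that that] by blast
  qed
  have G_gap: "\<delta> \<le> x" if "x \<in> G" "0 < x" for x
    using that \<delta>(2) unfolding G_def by auto
  have G_nat: "x - real n * y \<in> G" if "x \<in> G" "y \<in> G" for x y n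
  proof (induction n)
    case (Suc n)
    then show ?case using G_diff[OF Suc that(2)] by (simp add: algebra_simps)
  qed (use that in simp)
  have G_int: "x - of_int k * y \<in> G" if "x \<in> G" "y \<in> G" for x y k
  proof (cases "k \<ge> 0")
    case True
    then show ?thesis using G_nat[OF that, of "nat k"] by simp
  next
    case False
    have "0 - y \<in> G" using G_diff[OF G_diff[OF that(2) that(2)] that(2)] by simp
    then show ?thesis using G_nat[OF that(1), of "0 - y" "nat (- k)"] False by simp
  qed
  \<comment> \<open>A positive element whose size, measured in units of \<open>\<delta>\<close> and rounded down, is minimal
     generates the group \<open>G\<close>: a nonzero remainder \<open>r\<close> would satisfy \<open>d - r < \<delta>\<close>.\<close>
  obtain d where d: "d \<in> G" "d > 0" "\<And>g. g \<in> G \<Longrightarrow> g > 0 \<Longrightarrow> nat \<lfloor>d / \<delta>\<rfloor> \<le> nat \<lfloor>g / \<delta>\<rfloor>"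
    using ex_has_least_nat[of "\<lambda>g. g \<in> G \<and> g > 0" p "\<lambda>g. nat \<lfloor>g / \<delta>\<rfloor>"] S_G[OF p(1)] p(2)
    by blast
  show ?thesis
  proof (rule lattice[OF d(2)])
    fix x assume "x \<in> S"
    define k where "k = \<lfloor>x / d\<rfloor>"
    define r where "r = x - of_int k * d"
    have r_G: "r \<in> G" using G_int[OF S_G[OF \<open>x \<in> S\<close>] d(1)] by (simp add: r_def)
    have "of_int k \<le> x / d" "x / d < of_int k + 1" unfolding k_def by linarith+
    then have r: "0 \<le> r" "r < d" using d(2) by (auto simp: r_def field_simps)
    have "r = 0"
    proof (rule ccontr)
      assume "r \<noteq> 0"
      then have "nat \<lfloor>d / \<delta>\<rfloor> \<le> nat \<lfloor>r / \<delta>\<rfloor>" using d(3)[OF r_G] r by auto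
      moreover have "0 \<le> r / \<delta>" "0 \<le> d / \<delta>" using r \<delta> d by auto
      ultimately have "d / \<delta> - r / \<delta> < 1" by linarith
      then have "d - r < \<delta>" using \<delta> by (simp add: field_simps)
      then show False using G_gap[OF G_diff[OF d(1) r_G]] r by simp
    qed
    then show "\<exists>k::int. x = d * of_int k" by (auto simp: r_def mult.commute)
  qed
qed

definition support :: "real measure \<Rightarrow> real set"
  where "support \<mu> = {x. \<forall>\<delta>>0. emeasure \<mu> (ball x \<delta>) > 0}"

text \<open>The complement of the support is a union of open null balls, and countably many of them
  suffice to cover it.\<close>

lemma AE_support:
  assumes "sets \<mu> = sets borel"
  shows "AE x in \<mu>. x \<in> support \<mu>"
proof -
  define F where "F = {ball x r |x r. emeasure \<mu> (ball x r) = 0}"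
  obtain F' where F': "F' \<subseteq> F" "countable F'" "\<Union>F' = \<Union>F"
    using Lindelof[of F] unfolding F_def by blast
  have "\<Union>F' \<in> null_sets \<mu>"
    using F' assms by (intro null_sets_UN'[where N = "\<lambda>x. x" and I = F', simplified]) (auto simp: F_def null_sets_def)
  moreover have "{x. x \<notin> support \<mu>} \<subseteq> \<Union>F'"
    unfolding F'(3) F_def support_def by (auto simp: not_less) (metis centre_in_ball)
  ultimately show ?thesis
    using sets_eq_imp_space_eq[OF assms] by (intro AE_I') auto
qed

context renewal_law
begin

lemma bounded_integrable:
  assumes "continuous_on UNIV f" "\<And>x. \<bar>f x\<bar> \<le> B"
  shows "integrable \<mu> (\<lambda>y. f (t - y) :: real)"
proof (rule integrable_const_bound[where B = B])
  have "continuous_on UNIV (\<lambda>y. f (t - y))"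
    by (rule continuous_on_compose2[OF assms(1)]) (auto intro: continuous_intros)
  then have "(\<lambda>y. f (t - y)) \<in> borel_measurable borel"
    by (rule borel_measurable_continuous_onI)
  then show "(\<lambda>y. f (t - y)) \<in> borel_measurable \<mu>"
    using sets_borel by (simp cong: measurable_cong_sets)
qed (use assms(2) in simp)

text \<open>Where \<open>D\<close> is nearly maximal, harmonicity makes it an average of values that are hardly larger,
  hence nearly all of them are nearly maximal too; uniform continuity carries this over to each
  point of the support.\<close>

lemma harmonic_limsup_step:
  fixes D :: "real \<Rightarrow> real"
  assumes cont: "uniformly_continuous_on UNIV D" and bound: "\<And>x. \<bar>D x\<bar> \<le> B"
    and harmonic: "\<And>t. t \<ge> T \<Longrightarrow> D t = (\<integral>y. D (t - y) \<partial>\<mu>)"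
    and upper: "\<And>\<epsilon>. \<epsilon> > 0 \<Longrightarrow> eventually (\<lambda>x. D x < L + \<epsilon>) at_top"
    and t: "filterlim t at_top sequentially" "(\<lambda>n. D (t n)) \<longlonglongrightarrow> L"
    and b: "b \<in> support \<mu>"
  shows "(\<lambda>n. D (t n - b)) \<longlonglongrightarrow> L"
proof -
  have D_cont: "continuous_on UNIV D"
    using cont by (rule uniformly_continuous_imp_continuous)
  \<comment> \<open>Deficit and excess of \<open>D\<close> over \<open>L\<close>: the mean excess vanishes by dominated convergence,
     so the mean deficit vanishes as well.\<close>
  define \<phi> where "\<phi> = (\<lambda>n y. max 0 (L - D (t n - y)))"
  define \<psi> where "\<psi> = (\<lambda>n y. max 0 (D (t n - y) - L))"
  have D_int: "integrable \<mu> (\<lambda>y. D (t n - y))" for n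
    by (rule bounded_integrable[OF D_cont bound])
  have \<phi>_int: "integrable \<mu> (\<phi> n)" and \<psi>_int: "integrable \<mu> (\<psi> n)" for n
    unfolding \<phi>_def \<psi>_def using D_int[of n] by auto
  have shift: "eventually (\<lambda>n. D (t n - y) < L + \<epsilon>) sequentially" if "\<epsilon> > 0" for y \<epsilon>
  proof -
    have "filterlim (\<lambda>n. - y + t n) at_top sequentially"
      by (rule filterlim_tendsto_add_at_top[OF tendsto_const t(1)])
    from eventually_compose_filterlim[OF upper[OF that] this] show ?thesis by simp
  qed
  have \<psi>_lim: "(\<lambda>n. \<integral>y. \<psi> n y \<partial>\<mu>) \<longlonglongrightarrow> (\<integral>y. 0 \<partial>\<mu>)"
  proof (rule integral_dominated_convergence[where w = "\<lambda>_. B + \<bar>L\<bar>"])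
    show "AE y in \<mu>. (\<lambda>n. \<psi> n y) \<longlonglongrightarrow> 0"
    proof (intro AE_I2 order_tendstoI)
      fix y e :: real
      show "eventually (\<lambda>n. \<psi> n y < e) sequentially" if "0 < e"
        using shift[OF that, of y] by eventually_elim (use that in \<open>auto simp: \<psi>_def\<close>)
      show "eventually (\<lambda>n. e < \<psi> n y) sequentially" if "e < 0"
        using that by (auto simp: \<psi>_def less_max_iff_disj)
    qed
    show "AE y in \<mu>. norm (\<psi> n y) \<le> B + \<bar>L\<bar>" for n
    proof (rule AE_I2)
      fix y show "norm (\<psi> n y) \<le> B + \<bar>L\<bar>"
        using bound[of "t n - y"] by (auto simp: \<psi>_def)
    qed
  qed (use \<psi>_int in \<open>auto intro: borel_measurable_integrable\<close>)
  have "eventually (\<lambda>n. t n \<ge> T) sequentially"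
    using t(1) by (simp add: filterlim_at_top)
  then have "eventually (\<lambda>n. (\<integral>y. \<psi> n y \<partial>\<mu>) - (D (t n) - L) = (\<integral>y. \<phi> n y \<partial>\<mu>)) sequentially"
  proof eventually_elim
    case (elim n)
    have "D (t n) - L = (\<integral>y. D (t n - y) - L \<partial>\<mu>)"
      using harmonic[OF elim] D_int[of n] prob_space by simp
    also have "\<dots> = (\<integral>y. \<psi> n y - \<phi> n y \<partial>\<mu>)"
      by (intro Bochner_Integration.integral_cong) (auto simp: \<phi>_def \<psi>_def)
    also have "\<dots> = (\<integral>y. \<psi> n y \<partial>\<mu>) - (\<integral>y. \<phi> n y \<partial>\<mu>)"
      using \<phi>_int \<psi>_int by (intro Bochner_Integration.integral_diff)
    finally show ?case by simp
  qed
  moreover have "(\<lambda>n. (\<integral>y. \<psi> n y \<partial>\<mu>) - (D (t n) - L)) \<longlonglongrightarrow> (\<integral>y. 0 \<partial>\<mu>) - (L - L)"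
    by (intro tendsto_intros \<psi>_lim t)
  ultimately have \<phi>_lim: "(\<lambda>n. \<integral>y. \<phi> n y \<partial>\<mu>) \<longlonglongrightarrow> 0"
    by (simp add: Lim_transform_eventually)
  show ?thesis
  proof (rule order_tendstoI)
    fix e assume "L < e"
    then show "eventually (\<lambda>n. D (t n - b) < e) sequentially"
      using shift[of "e - L" b] by simp
  next
    fix e assume "e < L"
    define \<epsilon> where "\<epsilon> = L - e"
    have \<epsilon>: "\<epsilon> > 0" using \<open>e < L\<close> by (simp add: \<epsilon>_def)
    obtain \<delta> where \<delta>: "\<delta> > 0" "\<And>x y. dist y x < \<delta> \<Longrightarrow> dist (D y) (D x) < \<epsilon> / 2"
      using cont \<epsilon> unfolding uniformly_continuous_on_def by (metis UNIV_I half_gt_zero)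
    define p where "p = measure \<mu> (ball b \<delta>)"
    have p: "p > 0"
      using b \<delta>(1) unfolding p_def support_def by (simp add: emeasure_eq_measure)
    have "eventually (\<lambda>n. (\<integral>y. \<phi> n y \<partial>\<mu>) < p * \<epsilon> / 2) sequentially"
      using \<phi>_lim p \<epsilon> by (intro order_tendstoD) auto
    then show "eventually (\<lambda>n. e < D (t n - b)) sequentially"
    proof eventually_elim
      case (elim n)
      have "(\<integral>y. (\<phi> n b - \<epsilon> / 2) * indicator (ball b \<delta>) y \<partial>\<mu>) \<le> (\<integral>y. \<phi> n y \<partial>\<mu>)"
      proof (rule integral_mono)
        show "integrable \<mu> (\<lambda>y. (\<phi> n b - \<epsilon> / 2) * indicator (ball b \<delta>) y)"
          by (intro integrable_mult_right integrable_real_indicator) (auto simp: less_top[symmetric])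
        fix y
        show "(\<phi> n b - \<epsilon> / 2) * indicator (ball b \<delta>) y \<le> \<phi> n y"
        proof (cases "y \<in> ball b \<delta>")
          case True
          then have "dist (D (t n - y)) (D (t n - b)) < \<epsilon> / 2"
            by (intro \<delta>(2)) (simp add: dist_real_def)
          then have "D (t n - y) \<le> D (t n - b) + \<epsilon> / 2"
            unfolding dist_real_def by linarith
          then show ?thesis using True \<epsilon> by (simp add: \<phi>_def max_def)
        qed (simp add: \<phi>_def)
      qed (rule \<phi>_int)
      also have "(\<integral>y. (\<phi> n b - \<epsilon> / 2) * indicator (ball b \<delta>) y \<partial>\<mu>) = (\<phi> n b - \<epsilon> / 2) * p"
        by (simp add: p_def)
      finally have "p * (\<phi> n b - \<epsilon> / 2) < p * (\<epsilon> / 2)" using elim by (simp add: mult.commute)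
      then have "\<phi> n b < \<epsilon>" using p by simp
      then show ?case using \<epsilon> by (auto simp: \<phi>_def \<epsilon>_def)
    qed
  qed
qed

text \<open>Let \<open>D\<close> be the increment of \<open>Z\<close> over a step \<open>s\<close> and \<open>L\<close> its upper limit. By
  \<open>harmonic_limsup_step\<close> a near-maximal value of \<open>D\<close> at \<open>t\<close> propagates to \<open>t - a\<close> for all \<open>a\<close> in the
  semigroup generated by the support, which is eventually dense. Hence \<open>D\<close> is close to \<open>L\<close> along
  arbitrarily many consecutive steps, and if \<open>L\<close> were positive, \<open>Z\<close> would be unbounded.\<close>

lemma harmonic_increment_limsup:
  fixes Z :: "real \<Rightarrow> real"
  assumes nonlattice: "nonlattice \<mu>"
    and cont: "uniformly_continuous_on UNIV Z" and bound: "\<And>x. \<bar>Z x\<bar> \<le> B"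
    and harmonic: "\<And>t. t \<ge> T \<Longrightarrow> Z t = (\<integral>y. Z (t - y) \<partial>\<mu>)"
    and "s > 0" "\<epsilon> > 0"
  shows "eventually (\<lambda>t. Z (t + s) - Z t < \<epsilon>) at_top"
proof (rule ccontr)
  assume contra: "\<not> ?thesis"
  define D where "D = (\<lambda>t. Z (t + s) - Z t)"
  have Z_cont: "continuous_on UNIV Z"
    using cont by (rule uniformly_continuous_imp_continuous)
  have Z_int: "integrable \<mu> (\<lambda>y. Z (t - y))" for t
    by (rule bounded_integrable[OF Z_cont bound])
  have D_bound: "\<bar>D x\<bar> \<le> 2 * B" for x
    using bound[of x] bound[of "x + s"] by (simp add: D_def)
  have D_cont: "uniformly_continuous_on UNIV D"
    unfolding uniformly_continuous_on_def
  proof (intro allI impI)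
    fix e :: real assume "e > 0"
    then obtain d where d: "d > 0" "\<And>x y. dist y x < d \<Longrightarrow> dist (Z y) (Z x) < e / 2"
      using cont unfolding uniformly_continuous_on_def by (metis UNIV_I half_gt_zero)
    show "\<exists>d>0. \<forall>x\<in>UNIV. \<forall>y\<in>UNIV. dist y x < d \<longrightarrow> dist (D y) (D x) < e"
    proof (intro exI[of _ d] conjI ballI impI d(1))
      fix x y :: real assume "dist y x < d"
      then have "dist (Z y) (Z x) < e / 2" "dist (Z (y + s)) (Z (x + s)) < e / 2"
        using d(2)[of y x] d(2)[of "y + s" "x + s"] by (auto simp: dist_real_def)
      then show "dist (D y) (D x) < e" unfolding D_def dist_real_def by linarith
    qed
  qed
  have D_harmonic: "D t = (\<integral>y. D (t - y) \<partial>\<mu>)" if "t \<ge> T" for t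
  proof -
    have "D t = (\<integral>y. Z (t + s - y) \<partial>\<mu>) - (\<integral>y. Z (t - y) \<partial>\<mu>)"
      using harmonic[of t] harmonic[of "t + s"] that \<open>s > 0\<close> by (simp add: D_def)
    also have "\<dots> = (\<integral>y. Z (t + s - y) - Z (t - y) \<partial>\<mu>)"
      using Z_int by (intro Bochner_Integration.integral_diff[symmetric])
    finally show ?thesis by (simp add: D_def algebra_simps)
  qed
  define U where "U x = (SUP y\<in>{x..}. D y)" for x
  define L where "L = (INF x. U x)"
  have bdd: "bdd_above (D ` {x..})" for x
    using D_bound by (intro bdd_aboveI2[where M = "2 * B"]) (simp add: abs_le_iff)
  have U_lower: "- (2 * B) \<le> U x" for x
    using cSUP_upper[OF _ bdd, of x x] D_bound[of x] by (simp add: U_def abs_le_iff)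
  have L_le: "L \<le> U x" for x
    unfolding L_def using U_lower by (intro cINF_lower bdd_belowI2[where m = "- (2 * B)"]) auto
  have upper: "eventually (\<lambda>x. D x < L + e) at_top" if "e > 0" for e
  proof -
    have "\<exists>x. U x < L + e"
    proof (rule ccontr)
      assume "\<not> ?thesis"
      then have "L + e \<le> L" unfolding L_def by (intro cINF_greatest) (auto simp: not_less L_def)
      with that show False by simp
    qed
    then obtain x where x: "U x < L + e" by blast
    have "D y < L + e" if "y \<ge> x" for y
      using cSUP_upper[OF _ bdd, of y x] that x by (simp add: U_def)
    then show ?thesis unfolding eventually_at_top_linorder by blast
  qed
  have "L \<ge> \<epsilon>"
  proof (rule ccontr)
    assume "\<not> L \<ge> \<epsilon>"
    then show False using upper[of "\<epsilon> - L"] contra by (simp add: D_def)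
  qed
  then have "L > 0" using \<open>\<epsilon> > 0\<close> by simp
  have "\<exists>x\<ge>real n. D x > L - inverse (real (Suc n))" for n
  proof (rule ccontr)
    assume "\<not> ?thesis"
    then have "U (real n) \<le> L - inverse (real (Suc n))"
      unfolding U_def by (intro cSUP_least) (auto simp: not_less)
    moreover have "0 < inverse (real (Suc n))" by simp
    ultimately show False using L_le[of "real n"] by linarith
  qed
  then obtain t where t: "\<And>n. t n \<ge> real n" "\<And>n. D (t n) > L - inverse (real (Suc n))"
    by metis
  have t_top: "filterlim t at_top sequentially"
    by (rule filterlim_at_top_mono[OF filterlim_real_sequentially]) (simp add: t)
  have t_lim: "(\<lambda>n. D (t n)) \<longlonglongrightarrow> L"
  proof (rule order_tendstoI)
    fix e assume "L < e"
    then show "eventually (\<lambda>n. D (t n) < e) sequentially"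
      using eventually_compose_filterlim[OF upper[of "e - L"] t_top] by simp
  next
    fix e assume "e < L"
    have "(\<lambda>n. L - inverse (real (Suc n))) \<longlonglongrightarrow> L - 0"
      by (intro tendsto_intros LIMSEQ_inverse_real_of_nat)
    then have "eventually (\<lambda>n. e < L - inverse (real (Suc n))) sequentially"
      using \<open>e < L\<close> by (intro order_tendstoD) auto
    then show "eventually (\<lambda>n. e < D (t n)) sequentially"
      by eventually_elim (use t(2) order.strict_trans in blast)
  qed
  \<comment> \<open>Quantifying over all sequences makes this set closed under addition.\<close>
  define S where "S = {a. \<forall>t. filterlim t at_top sequentially \<longrightarrow> (\<lambda>n. D (t n)) \<longlonglongrightarrow> L \<longrightarrow>
    (\<lambda>n. D (t n - a)) \<longlonglongrightarrow> L}"
  have S_support: "support \<mu> \<subseteq> S"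
    unfolding S_def using harmonic_limsup_step[OF D_cont D_bound D_harmonic upper] by blast
  have S_add: "a + b \<in> S" if "a \<in> S" "b \<in> S" for a b
    unfolding S_def
  proof (intro CollectI allI impI)
    fix t assume t: "filterlim t at_top sequentially" "(\<lambda>n. D (t n)) \<longlonglongrightarrow> L"
    have "(\<lambda>n. D (t n - a)) \<longlonglongrightarrow> L" using that(1) t unfolding S_def by blast
    moreover have "filterlim (\<lambda>n. t n - a) at_top sequentially"
      using filterlim_tendsto_add_at_top[OF tendsto_const[of "- a"] t(1)] by simp
    ultimately have "(\<lambda>n. D (t n - a - b)) \<longlonglongrightarrow> L" using that(2) unfolding S_def by blast
    then show "(\<lambda>n. D (t n - (a + b))) \<longlonglongrightarrow> L" by (simp add: algebra_simps)
  qed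
  have "AE y in \<mu>. y \<in> support \<mu> \<and> 0 < y"
    using AE_support[OF sets_borel] AE_pos by eventually_elim simp
  then obtain p where p: "p \<in> S" "p > 0"
    using S_support eventually_happens' ae_filter_bot by (metis (mono_tags, lifting) subset_iff)
  show False
  proof (rule additive_semigroup_dichotomy[of S p])
    show "a + b \<in> S" if "a \<in> S" "b \<in> S" for a b using that by (rule S_add)
    show "p \<in> S" "p > 0" by (fact p)+
  next
    fix d assume lattice: "d > 0" "\<And>x. x \<in> S \<Longrightarrow> \<exists>k::int. x = d * of_int k"
    have "AE y in \<mu>. y \<in> range (\<lambda>n::nat. d * real n)"
      using AE_support[OF sets_borel] AE_pos
    proof eventually_elim
      case (elim y)
      then obtain k :: int where k: "y = d * of_int k" using lattice(2) S_support by blast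
      then have "k > 0" using elim lattice(1) by (simp add: zero_less_mult_iff)
      then have "y = d * real (nat k)" using k by simp
      then show ?case by blast
    qed
    then show False using nonlattice lattice(1) unfolding nonlattice_def by blast
  next
    assume dense: "\<And>\<delta>. \<delta> > 0 \<Longrightarrow> \<exists>A. \<forall>x\<ge>A. \<exists>s\<in>S. \<bar>x - s\<bar> < \<delta>"
    obtain N :: nat where N: "2 * B < real N * (L / 2)"
      using reals_Archimedean3[of "L / 2", THEN spec, of "2 * B"] \<open>L > 0\<close> half_gt_zero by blast
    obtain \<delta> where \<delta>: "\<delta> > 0" "\<And>x y. dist y x < \<delta> \<Longrightarrow> dist (D y) (D x) < L / 4"
      using D_cont \<open>L > 0\<close> unfolding uniformly_continuous_on_def by (metis UNIV_I zero_less_divide_iff zero_less_numeral)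
    obtain A where A: "\<And>x. x \<ge> A \<Longrightarrow> \<exists>a\<in>S. \<bar>x - a\<bar> < \<delta>" using dense[OF \<delta>(1)] by blast
    have "\<exists>a\<in>S. \<bar>A + real i * s - a\<bar> < \<delta>" for i
      using \<open>s > 0\<close> by (intro A) simp
    then obtain a where a: "\<And>i. a i \<in> S" "\<And>i. \<bar>A + real i * s - a i\<bar> < \<delta>" by metis
    have "eventually (\<lambda>n. D (t n - a i) > 3 * L / 4) sequentially" for i
      using a(1)[of i] t_top t_lim \<open>L > 0\<close> unfolding S_def
      by (intro order_tendstoD(1)[where y = L]) auto
    then have "eventually (\<lambda>n. \<forall>i\<in>{..<N}. D (t n - a i) > 3 * L / 4) sequentially"
      by (intro eventually_ball_finite) auto
    then obtain n where n: "\<And>i. i < N \<Longrightarrow> D (t n - a i) > 3 * L / 4"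
      by (auto simp: eventually_sequentially)
    define c where "c = t n - A"
    have "D (c - real i * s) \<ge> L / 2" if "i < N" for i
    proof -
      have "dist (D (c - real i * s)) (D (t n - a i)) < L / 4"
        using a(2)[of i] by (intro \<delta>(2)) (auto simp: c_def dist_real_def abs_minus_commute algebra_simps)
      then show ?thesis using n[OF that] unfolding dist_real_def by linarith
    qed
    then have "real N * (L / 2) \<le> (\<Sum>i<N. D (c - real i * s))"
      using sum_bounded_below[of "{..<N}" "L / 2" "\<lambda>i. D (c - real i * s)"] by simp
    also have "\<dots> = (\<Sum>i<N. Z (c + s - real i * s) - Z (c + s - real (Suc i) * s))"
      by (intro sum.cong) (auto simp: D_def algebra_simps)
    also have "\<dots> = Z (c + s) - Z (c + s - real N * s)"
      using sum_lessThan_telescope'[of "\<lambda>i. Z (c + s - real i * s)" N] by simp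
    also have "\<dots> \<le> 2 * B"
      using bound[of "c + s"] bound[of "c + s - real N * s"] by (simp add: abs_le_iff)
    finally show False using N by simp
  qed
qed

lemma harmonic_increment_tendsto_0:
  fixes Z :: "real \<Rightarrow> real"
  assumes "nonlattice \<mu>"
    and "uniformly_continuous_on UNIV Z" and "\<And>x. \<bar>Z x\<bar> \<le> B"
    and "\<And>t. t \<ge> T \<Longrightarrow> Z t = (\<integral>y. Z (t - y) \<partial>\<mu>)"
    and "s > 0"
  shows "((\<lambda>t. Z (t + s) - Z t) \<longlongrightarrow> 0) at_top"
proof (rule order_tendstoI)
  fix e :: real assume "0 < e"
  then show "eventually (\<lambda>t. Z (t + s) - Z t < e) at_top"
    by (intro harmonic_increment_limsup[where B = B and T = T] assms)
next
  fix e :: real assume "e < 0"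
  have "eventually (\<lambda>t. (- Z (t + s)) - (- Z t) < - e) at_top"
  proof (rule harmonic_increment_limsup[where B = B and T = T, OF assms(1) _ _ _ assms(5)])
    show "uniformly_continuous_on UNIV (\<lambda>t. - Z t)"
      by (rule uniformly_continuous_on_minus[OF assms(2)])
    show "- Z t = (\<integral>y. - Z (t - y) \<partial>\<mu>)" if "T \<le> t" for t
      using assms(4)[OF that] by simp
  qed (use assms(3) \<open>e < 0\<close> in auto)
  then show "eventually (\<lambda>t. e < Z (t + s) - Z t) at_top"
    by eventually_elim simp
qed

end

section \<open>Blackwell's theorem\<close>

context renewal_law
begin

text \<open>Fubini's theorem for the region \<open>0 \<le> x < y\<close>.\<close>

lemma nn_integral_tail: "(\<integral>\<^sup>+x. tail x \<partial>lborel) = (\<integral>\<^sup>+y. ennreal y \<partial>\<mu>)"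
proof -
  interpret pair_sigma_finite lborel \<mu> ..
  have "(\<integral>\<^sup>+x. tail x \<partial>lborel) = (\<integral>\<^sup>+x. \<integral>\<^sup>+y. indicator {0..} x * indicator {0<..} (y - x) \<partial>\<mu> \<partial>lborel)"
  proof (intro nn_integral_cong)
    fix x :: real
    have "(\<integral>\<^sup>+y. indicator {0..} x * indicator {0<..} (y - x) \<partial>\<mu>)
        = (\<integral>\<^sup>+y. indicator {0..} x * indicator {x<..} y \<partial>\<mu>)"
      by (intro nn_integral_cong) (auto split: split_indicator)
    also have "\<dots> = tail x" by (simp add: tail_def nn_integral_cmult)
    finally show "tail x = (\<integral>\<^sup>+y. indicator {0..} x * indicator {0<..} (y - x) \<partial>\<mu>)" by simp
  qed
  also have "\<dots> = (\<integral>\<^sup>+y. \<integral>\<^sup>+x. indicator {0..} x * indicator {0<..} (y - x) \<partial>lborel \<partial>\<mu>)"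
    by (rule Fubini'[symmetric]) simp
  also have "\<dots> = (\<integral>\<^sup>+y. ennreal y \<partial>\<mu>)"
  proof (rule nn_integral_cong_AE, use AE_nonneg in eventually_elim)
    fix y :: real assume "0 \<le> y"
    have "(\<integral>\<^sup>+x. indicator {0..} x * indicator {0<..} (y - x) \<partial>lborel)
        = (\<integral>\<^sup>+x. indicator {0..<y} x \<partial>lborel)"
      by (intro nn_integral_cong) (auto split: split_indicator)
    also have "\<dots> = ennreal y" using \<open>0 \<le> y\<close> by simp
    finally show "(\<integral>\<^sup>+x. indicator {0..} x * indicator {0<..} (y - x) \<partial>lborel) = ennreal y" .
  qed
  finally show ?thesis .
qed

lemma mean_pos:
  assumes "integrable \<mu> (\<lambda>y. y)"
  shows "(\<integral>y. y \<partial>\<mu>) > 0"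
proof -
  have "(\<integral>y. y \<partial>\<mu>) \<ge> 0"
    using AE_nonneg by (rule integral_nonneg_AE)
  moreover have "(\<integral>y. y \<partial>\<mu>) \<noteq> 0"
  proof
    assume "(\<integral>y. y \<partial>\<mu>) = 0"
    then have "AE y in \<mu>. y = 0"
      using integral_nonneg_eq_0_iff_AE[OF assms AE_nonneg] by simp
    with AE_pos have "AE y in \<mu>. False" by eventually_elim simp
    then show False by simp
  qed
  ultimately show ?thesis by simp
qed

text \<open>For a Lipschitz test function \<open>z\<close> of compact support the renewal equation makes
  \<open>Z = renewal \<mu> z\<close> harmonic far out, so \<open>Z\<close> is asymptotically invariant under shifts.
  Since the renewal operator maps \<open>tail\<close> to \<open>heaviside\<close>, averaging the shifts of \<open>Z\<close> with
  weight \<open>tail\<close>, whose mass is the mean of \<open>\<mu>\<close>, yields exactly the integral of \<open>z\<close>; this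
  determines the limit.\<close>

lemma renewal_lipschitz_limit:
  fixes z :: "real \<Rightarrow> real"
  assumes nonlattice: "nonlattice \<mu>" and mean: "integrable \<mu> (\<lambda>y. y)"
    and nonneg: "\<And>x. 0 \<le> z x"
    and lipschitz: "\<And>x y. \<bar>z x - z y\<bar> \<le> K * \<bar>x - y\<bar>" and "K \<ge> 0"
    and compact_support: "\<And>x. R < \<bar>x\<bar> \<Longrightarrow> z x = 0" and "R \<ge> 0"
  shows "((\<lambda>t. enn2real (renewal \<mu> (\<lambda>x. ennreal (z x)) t)) \<longlongrightarrow> (\<integral>x. z x \<partial>lborel) / (\<integral>y. y \<partial>\<mu>)) at_top"
proof -
  define m where "m = (\<integral>y. y \<partial>\<mu>)"
  have "m > 0" using mean_pos[OF mean] by (simp add: m_def)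
  define f where "f x = ennreal (z x)" for x
  define Z where "Z t = enn2real (renewal \<mu> f t)" for t
  have "continuous_on UNIV z"
  proof (rule uniformly_continuous_imp_continuous, unfold uniformly_continuous_on_def, intro allI impI)
    fix e :: real assume "e > 0"
    \<comment> \<open>The summand \<open>1\<close> in the denominator covers \<open>K = 0\<close>.\<close>
    show "\<exists>d>0. \<forall>x\<in>UNIV. \<forall>y\<in>UNIV. dist y x < d \<longrightarrow> dist (z y) (z x) < e"
    proof (intro exI[of _ "e / (K + 1)"] conjI ballI impI)
      fix x y :: real assume "dist y x < e / (K + 1)"
      then have "\<bar>y - x\<bar> * (K + 1) < e" using \<open>K \<ge> 0\<close> by (simp add: dist_real_def field_simps)
      moreover have "K * \<bar>y - x\<bar> \<le> \<bar>y - x\<bar> * (K + 1)" by (simp add: algebra_simps)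
      ultimately show "dist (z y) (z x) < e"
        using lipschitz[of y x] by (simp add: dist_real_def)
    qed (use \<open>e > 0\<close> \<open>K \<ge> 0\<close> in auto)
  qed
  then have z_meas [measurable]: "z \<in> borel_measurable borel"
    by (rule borel_measurable_continuous_onI)
  have f_meas [measurable]: "f \<in> borel_measurable borel"
    unfolding f_def by measurable
  \<comment> \<open>A bound for \<open>z\<close>, obtained by comparison with its zero at \<open>R + 1\<close>.\<close>
  define M where "M = K * (2 * R + 1)"
  have "M \<ge> 0" using \<open>K \<ge> 0\<close> \<open>R \<ge> 0\<close> by (simp add: M_def)
  have z_le: "z x \<le> M * indicator {-R..-R + 2 * R} x" for x
  proof (cases "\<bar>x\<bar> \<le> R")
    case True
    have "z x = \<bar>z x - z (R + 1)\<bar>"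
      using compact_support[of "R + 1"] nonneg[of x] \<open>R \<ge> 0\<close> by simp
    also have "\<dots> \<le> K * \<bar>x - (R + 1)\<bar>" by (rule lipschitz)
    also have "\<dots> \<le> M" unfolding M_def using True \<open>K \<ge> 0\<close> by (intro mult_left_mono) auto
    finally show ?thesis using True by (auto simp: indicator_def abs_le_iff)
  next
    case False
    then show ?thesis using compact_support[of x] \<open>M \<ge> 0\<close> by simp
  qed
  obtain C where C: "C < \<infinity>" "\<And>c t. renewal \<mu> (indicator {c..c + 2 * R}) t \<le> C"
    using renewal_interval_bounded[of "2 * R"] by blast
  have le: "renewal \<mu> f t \<le> ennreal M * C" for t
  proof -
    have "renewal \<mu> f t \<le> renewal \<mu> (\<lambda>x. ennreal M * indicator {-R..-R + 2 * R} x) t"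
    proof (rule renewal_causal_mono)
      fix x
      show "f x \<le> ennreal M * indicator {-R..-R + 2 * R} x"
        using z_le[of x] unfolding f_def by (auto split: split_indicator intro: ennreal_leI simp: ennreal_neg)
    qed
    also have "\<dots> = ennreal M * renewal \<mu> (indicator {-R..-R + 2 * R}) t"
      by (intro renewal_cmult) simp
    also have "\<dots> \<le> ennreal M * C" by (intro mult_left_mono C) simp
    finally show ?thesis .
  qed
  have MC: "ennreal M * C < \<infinity>"
    using C(1) by (simp add: ennreal_mult_less_top)
  have fin: "renewal \<mu> f t < \<infinity>" for t
    using le MC by (rule order.strict_trans1)
  have Z_le': "Z t \<le> enn2real (ennreal M * C)" for t
    unfolding Z_def using le MC by (intro enn2real_mono) auto
  define B where "B = enn2real (ennreal M * C)"
  have Z: "ennreal (Z t) = renewal \<mu> f t" for t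
    using fin[of t] by (simp add: Z_def)
  have Z_nonneg: "0 \<le> Z t" for t by (simp add: Z_def)
  have Z_bound: "\<bar>Z t\<bar> \<le> B" for t using Z_nonneg[of t] Z_le'[of t] by (simp add: B_def)
  obtain C' where C': "C' < \<infinity>" "\<And>c t. renewal \<mu> (indicator {c..c + 2 * (R + 1)}) t \<le> C'"
    using renewal_interval_bounded[of "2 * (R + 1)"] by blast
  define c where "c = enn2real C'"
  have c: "ennreal c = C'" "c \<ge> 0" using C'(1) by (auto simp: c_def)
  have Z_step: "Z (t + s) \<le> Z t + K * \<bar>s\<bar> * c" if "\<bar>s\<bar> \<le> 1" for s t
  proof -
    let ?I = "indicator {-(R + 1)..-(R + 1) + 2 * (R + 1)} :: real \<Rightarrow> ennreal"
    have "f (x + s) \<le> f x + ennreal (K * \<bar>s\<bar>) * ?I x" for x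
    proof (cases "\<bar>x\<bar> \<le> R + 1")
      case True
      have "z (x + s) \<le> z x + K * \<bar>s\<bar>" using lipschitz[of "x + s" x] by simp
      then have "f (x + s) \<le> ennreal (z x + K * \<bar>s\<bar>)" unfolding f_def by (rule ennreal_leI)
      also have "\<dots> = f x + ennreal (K * \<bar>s\<bar>)"
        unfolding f_def using nonneg \<open>K \<ge> 0\<close> by (intro ennreal_plus) auto
      finally show ?thesis using True by (auto simp: indicator_def abs_le_iff)
    next
      case False
      then have "R < \<bar>x + s\<bar>" using that by linarith
      then show ?thesis using compact_support by (simp add: f_def)
    qed
    then have "renewal \<mu> (\<lambda>x. f (x + s)) t \<le> renewal \<mu> (\<lambda>x. f x + ennreal (K * \<bar>s\<bar>) * ?I x) t"
      by (intro renewal_causal_mono)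
    also have "\<dots> = renewal \<mu> f t + ennreal (K * \<bar>s\<bar>) * renewal \<mu> ?I t"
      by (subst renewal_add) (auto simp: renewal_cmult)
    also have "\<dots> \<le> renewal \<mu> f t + ennreal (K * \<bar>s\<bar>) * ennreal c"
      unfolding c by (intro add_left_mono mult_left_mono C') auto
    also have "\<dots> = ennreal (Z t + K * \<bar>s\<bar> * c)"
      using Z_nonneg c(2) \<open>K \<ge> 0\<close> by (simp add: Z[symmetric] ennreal_mult[symmetric] ennreal_plus[symmetric] del: ennreal_plus)
    finally have "ennreal (Z (t + s)) \<le> ennreal (Z t + K * \<bar>s\<bar> * c)"
      by (simp only: renewal_shift[of f s t] Z)
    then show ?thesis
      using Z_nonneg[of t] c \<open>K \<ge> 0\<close> by (subst (asm) ennreal_le_iff) auto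
  qed
  have Z_cont: "uniformly_continuous_on UNIV Z"
    unfolding uniformly_continuous_on_def
  proof (intro allI impI)
    fix e :: real assume "e > 0"
    have "K * c \<ge> 0" using c \<open>K \<ge> 0\<close> by simp
    define d where "d = min 1 (e / (K * c + 1))"
    show "\<exists>d>0. \<forall>x\<in>UNIV. \<forall>y\<in>UNIV. dist y x < d \<longrightarrow> dist (Z y) (Z x) < e"
    proof (intro exI[of _ d] conjI ballI impI)
      show "d > 0" using \<open>e > 0\<close> \<open>K * c \<ge> 0\<close> by (simp add: d_def)
      fix x y :: real assume "dist y x < d"
      then have *: "\<bar>y - x\<bar> \<le> 1" "\<bar>y - x\<bar> < e / (K * c + 1)" by (auto simp: d_def dist_real_def)
      have "K * \<bar>y - x\<bar> * c \<le> \<bar>y - x\<bar> * (K * c + 1)" by (simp add: algebra_simps)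
      also have "\<dots> < e" using *(2) \<open>K * c \<ge> 0\<close> by (simp add: field_simps)
      finally have "K * \<bar>y - x\<bar> * c < e" .
      moreover have "Z y \<le> Z x + K * \<bar>y - x\<bar> * c" "Z x \<le> Z y + K * \<bar>y - x\<bar> * c"
        using Z_step[of "y - x" x] Z_step[of "x - y" y] *(1) by (auto simp: abs_minus_commute)
      ultimately show "dist (Z y) (Z x) < e" unfolding dist_real_def by linarith
    qed
  qed
  have [measurable]: "Z \<in> borel_measurable borel"
    unfolding Z_def by measurable
  have harmonic: "Z t = (\<integral>y. Z (t - y) \<partial>\<mu>)" if "t \<ge> R + 1" for t
  proof -
    have "renewal \<mu> f t = (\<integral>\<^sup>+y. ennreal (Z (t - y)) \<partial>\<mu>)"
      using compact_support[of t] that renewal_equation[of f t] by (simp add: f_def conv_fun_def Z)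
    then show ?thesis
      using Z_nonneg by (subst integral_eq_nn_integral) (auto simp: Z_def[of t])
  qed
  have increments: "((\<lambda>t. Z (t + s) - Z t) \<longlongrightarrow> 0) at_top" if "s > 0" for s
    by (rule harmonic_increment_tendsto_0[OF nonlattice Z_cont Z_bound harmonic that])
  have backward: "((\<lambda>t. Z (t - x) - Z t) \<longlongrightarrow> 0) at_top" if "x \<ge> 0" for x
  proof (cases "x = 0")
    case False
    have "filterlim (\<lambda>t. - x + t) at_top at_top"
      by (rule filterlim_tendsto_add_at_top[OF tendsto_const filterlim_ident])
    from filterlim_compose[OF increments[of x] this] that False
    have "((\<lambda>t. - (Z t - Z (t - x))) \<longlongrightarrow> - 0) at_top"
      by (intro tendsto_minus) (simp add: algebra_simps)
    then show ?thesis by simp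
  qed simp
  \<comment> \<open>Both \<open>tail\<close> and \<open>z\<close> are regarded as densities, so that their convolution can be taken in
     either order.\<close>
  define \<tau> where "\<tau> = density lborel tail"
  define \<zeta> where "\<zeta> = density lborel f"
  have \<tau>_mass: "emeasure \<tau> UNIV = ennreal m"
    using nn_integral_tail nn_integral_eq_integral[OF mean AE_nonneg]
    by (simp add: \<tau>_def emeasure_density m_def)
  have \<tau>_space: "space \<tau> = UNIV" by (simp add: \<tau>_def)
  interpret \<tau>: finite_measure \<tau>
    by (rule finite_measureI) (simp add: \<tau>_space \<tau>_mass)
  interpret \<tau>: sigma_finite_borel \<tau>
    by unfold_locales (simp add: \<tau>_def)
  have f_integral: "(\<integral>\<^sup>+x. f x \<partial>lborel) = ennreal (\<integral>x. z x \<partial>lborel)"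
  proof -
    have "integrable lborel z"
    proof (rule Bochner_Integration.integrable_bound)
      show "integrable lborel (\<lambda>x. M * indicator {-R..-R + 2 * R} x :: real)"
        by (intro integrable_mult_right integrable_real_indicator) (auto simp: emeasure_lborel_Icc_eq)
      show "AE x in lborel. norm (z x) \<le> norm (M * indicator {-R..-R + 2 * R} x)"
        using z_le nonneg \<open>M \<ge> 0\<close> by (intro AE_I2) simp
    qed simp
    then show ?thesis
      using nonneg unfolding f_def by (intro nn_integral_eq_integral) auto
  qed
  interpret \<zeta>: finite_measure \<zeta>
    by (rule finite_measureI) (simp add: \<zeta>_def emeasure_density f_integral)
  interpret \<zeta>: sigma_finite_borel \<zeta>
    by unfold_locales (simp add: \<zeta>_def)
  have swap: "\<tau> \<odot> f = \<zeta> \<odot> tail"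
  proof
    fix t
    have "(\<tau> \<odot> f) t = (\<integral>\<^sup>+x. tail x * f (t - x) \<partial>lborel)"
      by (simp add: conv_fun_def \<tau>_def nn_integral_density)
    also have "\<dots> = (\<integral>\<^sup>+x. tail (t - x) * f x \<partial>lborel)"
      by (subst nn_integral_real_affine[where c = "-1" and t = t]) auto
    also have "\<dots> = (\<zeta> \<odot> tail) t"
      by (simp add: conv_fun_def \<zeta>_def nn_integral_density mult.commute)
    finally show "(\<tau> \<odot> f) t = (\<zeta> \<odot> tail) t" .
  qed
  have average: "(\<integral>x. Z (t - x) \<partial>\<tau>) = (\<integral>x. z x \<partial>lborel)" if "t \<ge> R" for t
  proof -
    have "(\<integral>\<^sup>+x. ennreal (Z (t - x)) \<partial>\<tau>) = (\<tau> \<odot> renewal \<mu> f) t"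
      by (simp add: Z conv_fun_def)
    also have "\<dots> = renewal \<mu> (\<tau> \<odot> f) t"
      by (simp add: renewal_commute[OF \<tau>.sigma_finite_borel_axioms])
    also have "\<dots> = (\<zeta> \<odot> renewal \<mu> tail) t"
      by (simp add: swap renewal_commute[OF \<zeta>.sigma_finite_borel_axioms])
    also have "renewal \<mu> tail = heaviside" by (simp add: fun_eq_iff renewal_tail)
    also have "(\<zeta> \<odot> heaviside) t = (\<integral>\<^sup>+x. f x * heaviside (t - x) \<partial>lborel)"
      by (simp add: conv_fun_def \<zeta>_def nn_integral_density)
    also have "\<dots> = (\<integral>\<^sup>+x. f x \<partial>lborel)"
      using compact_support that by (intro nn_integral_cong) (auto simp: f_def split: split_indicator)
    finally show ?thesis
      using Z_nonneg f_integral nonneg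
      by (subst integral_eq_nn_integral) (auto simp: integral_nonneg_AE)
  qed
  have \<tau>_nonneg: "AE x in \<tau>. 0 \<le> x"
    unfolding \<tau>_def by (subst AE_density) (auto simp: tail_def split: split_indicator)
  have Z_int: "integrable \<tau> (\<lambda>x. Z (t - x))" for t
    by (rule \<tau>.integrable_const_bound[where B = B]) (use Z_bound in auto)
  have "((\<lambda>t. \<integral>x. Z (t - x) - Z t \<partial>\<tau>) \<longlongrightarrow> (\<integral>x. 0 \<partial>\<tau>)) at_top"
  proof (rule integral_dominated_convergence_at_top[where w = "\<lambda>_. 2 * B"])
    show "AE x in \<tau>. ((\<lambda>t. Z (t - x) - Z t) \<longlongrightarrow> 0) at_top"
      using \<tau>_nonneg by eventually_elim (rule backward)
    show "\<forall>\<^sub>F t in at_top. AE x in \<tau>. norm (Z (t - x) - Z t) \<le> 2 * B"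
    proof (intro always_eventually allI AE_I2)
      fix t x show "norm (Z (t - x) - Z t) \<le> 2 * B"
        using Z_bound[of "t - x"] Z_bound[of t] by (simp add: abs_le_iff)
    qed
  qed auto
  moreover have "(\<integral>x. Z (t - x) - Z t \<partial>\<tau>) = (\<integral>x. Z (t - x) \<partial>\<tau>) - Z t * m" for t
    using Z_int[of t] \<tau>_mass \<open>m > 0\<close> by (simp add: measure_def)
  ultimately have "((\<lambda>t. (\<integral>x. Z (t - x) \<partial>\<tau>) - Z t * m) \<longlongrightarrow> 0) at_top" by simp
  moreover have "eventually (\<lambda>t. (\<integral>x. Z (t - x) \<partial>\<tau>) - Z t * m = (\<integral>x. z x \<partial>lborel) - Z t * m) at_top"
    using eventually_ge_at_top[of R] by eventually_elim (simp add: average)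
  ultimately have "((\<lambda>t. (\<integral>x. z x \<partial>lborel) - Z t * m) \<longlongrightarrow> 0) at_top"
    by (rule Lim_transform_eventually)
  then have "((\<lambda>t. ((\<integral>x. z x \<partial>lborel) - ((\<integral>x. z x \<partial>lborel) - Z t * m)) / m) \<longlongrightarrow> ((\<integral>x. z x \<partial>lborel) - 0) / m) at_top"
    using \<open>m > 0\<close> by (intro tendsto_intros) auto
  then show ?thesis
    using \<open>m > 0\<close> by (simp add: Z_def f_def[abs_def] m_def)
qed

end

context renewal_law
begin

text \<open>The test function is squeezed between trapezoids, whose slopes have width \<open>\<delta>\<close>.
  Leaving its values at the end points open covers all kinds of intervals at once.\<close>

lemma blackwell:
  assumes nonlattice: "nonlattice \<mu>" and mean: "integrable \<mu> (\<lambda>y. y)" and "a < b"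
    and lower: "\<And>x. indicator {a<..<b} x \<le> f x" and upper: "\<And>x. f x \<le> indicator {a..b} x"
  shows "((\<lambda>t. enn2real (renewal \<mu> f t)) \<longlongrightarrow> (b - a) / (\<integral>y. y \<partial>\<mu>)) at_top"
proof -
  define m where "m = (\<integral>y. y \<partial>\<mu>)"
  have "m > 0" using mean_pos[OF mean] by (simp add: m_def)
  define trap :: "real \<Rightarrow> real \<Rightarrow> real \<Rightarrow> real \<Rightarrow> real"
    where "trap c d \<delta> x = max 0 (min 1 (1 - max (c - x) (x - d) / \<delta>))" for c d \<delta> x
  have trap_ge: "indicator {c..d} x \<le> trap c d \<delta> x" if "\<delta> > 0" for c d \<delta> x
  proof (cases "x \<in> {c..d}")
    case True
    then have "max (c - x) (x - d) / \<delta> \<le> 0" using that by (simp add: divide_le_0_iff)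
    then show ?thesis using True by (simp add: trap_def)
  qed (simp add: trap_def)
  have trap_le: "trap c d \<delta> x \<le> indicator {c - \<delta>..d + \<delta>} x" if "\<delta> > 0" for c d \<delta> x
  proof (cases "x \<in> {c - \<delta>..d + \<delta>}")
    case False
    then have "max (c - x) (x - d) / \<delta> \<ge> 1" using that by (auto simp: le_max_iff_disj)
    then show ?thesis using False by (simp add: trap_def)
  qed (simp add: trap_def)
  have trap_lipschitz: "\<bar>trap c d \<delta> x - trap c d \<delta> y\<bar> \<le> 1 / \<delta> * \<bar>x - y\<bar>" if "\<delta> > 0" for c d \<delta> x y
  proof -
    have "\<bar>trap c d \<delta> x - trap c d \<delta> y\<bar> \<le> \<bar>max (c - x) (x - d) / \<delta> - max (c - y) (y - d) / \<delta>\<bar>"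
      unfolding trap_def by linarith
    also have "\<dots> = \<bar>max (c - x) (x - d) - max (c - y) (y - d)\<bar> / \<delta>"
      using that by (simp add: diff_divide_distrib[symmetric])
    also have "\<dots> \<le> \<bar>x - y\<bar> / \<delta>"
      using that by (intro divide_right_mono) linarith+
    finally show ?thesis by simp
  qed
  have trap_limit: "((\<lambda>t. enn2real (renewal \<mu> (\<lambda>x. ennreal (trap c d \<delta> x)) t)) \<longlongrightarrow> (\<integral>x. trap c d \<delta> x \<partial>lborel) / m) at_top"
    if "\<delta> > 0" for c d \<delta>
    unfolding m_def
  proof (rule renewal_lipschitz_limit[OF nonlattice mean _ trap_lipschitz[OF that]])
    fix x assume "max (\<bar>c - \<delta>\<bar>) (\<bar>d + \<delta>\<bar>) < \<bar>x\<bar>"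
    then have "x \<notin> {c - \<delta>..d + \<delta>}" by auto
    then show "trap c d \<delta> x = 0"
      using trap_le[OF that, of c d x] by (simp add: trap_def)
  qed (use that in \<open>auto simp: trap_def\<close>)
  have [measurable]: "trap c d \<delta> \<in> borel_measurable borel" for c d \<delta>
    unfolding trap_def[abs_def] by measurable
  have trap_integrable: "integrable lborel (trap c d \<delta>)" if "\<delta> > 0" for c d \<delta>
  proof (rule Bochner_Integration.integrable_bound)
    show "integrable lborel (indicator {c - \<delta>..d + \<delta>} :: real \<Rightarrow> real)"
      by (intro integrable_real_indicator) (auto simp: emeasure_lborel_Icc_eq)
    show "AE x in lborel. norm (trap c d \<delta> x) \<le> norm (indicator {c - \<delta>..d + \<delta>} x :: real)"
      using trap_le[OF that] by (intro AE_I2) (simp add: trap_def)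
  qed simp
  have renewal_finite: "renewal \<mu> (indicator {c..d}) t < \<infinity>" for c d t
  proof -
    obtain C where "C < \<infinity>" "\<And>t. renewal \<mu> (indicator {c..c + (d - c)}) t \<le> C"
      using renewal_interval_bounded[of "d - c"] by blast
    then show ?thesis by (auto intro: order.strict_trans1)
  qed
  show ?thesis
    unfolding m_def[symmetric]
  proof (rule order_tendstoI)
    fix e assume "(b - a) / m < e"
    then have "b - a < m * e" using \<open>m > 0\<close> by (simp add: field_simps)
    define \<delta> where "\<delta> = (m * e - (b - a)) / 4"
    have "4 * \<delta> = m * e - (b - a)" by (simp add: \<delta>_def)
    then have \<delta>: "\<delta> > 0" "b - a + 2 * \<delta> < m * e" using \<open>b - a < m * e\<close> by linarith+
    have "(\<integral>x. trap a b \<delta> x \<partial>lborel) \<le> (\<integral>x. indicator {a - \<delta>..b + \<delta>} x \<partial>lborel)"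
      using trap_le[OF \<delta>(1)] trap_integrable[OF \<delta>(1)]
      by (intro integral_mono integrable_real_indicator) (auto simp: emeasure_lborel_Icc_eq)
    also have "\<dots> = b - a + 2 * \<delta>" using \<open>a < b\<close> \<delta> by simp
    finally have "(\<integral>x. trap a b \<delta> x \<partial>lborel) / m < e"
      using \<delta> \<open>m > 0\<close> by (simp add: field_simps)
    with trap_limit[OF \<delta>(1)]
    have "eventually (\<lambda>t. enn2real (renewal \<mu> (\<lambda>x. ennreal (trap a b \<delta> x)) t) < e) at_top"
      by (rule order_tendstoD)
    then show "eventually (\<lambda>t. enn2real (renewal \<mu> f t) < e) at_top"
    proof eventually_elim
      case (elim t)
      have "renewal \<mu> f t \<le> renewal \<mu> (\<lambda>x. ennreal (trap a b \<delta> x)) t"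
      proof (rule renewal_causal_mono)
        fix x
        have "f x \<le> indicator {a..b} x" by (rule upper)
        also have "\<dots> = ennreal (indicator {a..b} x)" by (auto split: split_indicator)
        also have "\<dots> \<le> ennreal (trap a b \<delta> x)" by (intro ennreal_leI trap_ge \<delta>)
        finally show "f x \<le> ennreal (trap a b \<delta> x)" .
      qed
      moreover have "renewal \<mu> (\<lambda>x. ennreal (trap a b \<delta> x)) t < \<infinity>"
      proof (rule order.strict_trans1[OF renewal_causal_mono renewal_finite])
        fix x
        have "ennreal (trap a b \<delta> x) \<le> ennreal (indicator {a - \<delta>..b + \<delta>} x)"
          by (intro ennreal_leI trap_le \<delta>)
        also have "\<dots> = indicator {a - \<delta>..b + \<delta>} x" by (auto split: split_indicator)
        finally show "ennreal (trap a b \<delta> x) \<le> indicator {a - \<delta>..b + \<delta>} x" .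
      qed
      ultimately have "enn2real (renewal \<mu> f t) \<le> enn2real (renewal \<mu> (\<lambda>x. ennreal (trap a b \<delta> x)) t)"
        by (intro enn2real_mono) auto
      then show ?case using elim by simp
    qed
  next
    fix e assume "e < (b - a) / m"
    then have "m * e < b - a" using \<open>m > 0\<close> by (simp add: field_simps)
    define \<delta> where "\<delta> = min ((b - a) / 8) ((b - a - m * e) / 8)"
    have "\<delta> \<le> (b - a) / 8" unfolding \<delta>_def by (rule min.cobounded1)
    then have 1: "8 * \<delta> \<le> b - a" by simp
    have "\<delta> \<le> (b - a - m * e) / 8" unfolding \<delta>_def by (rule min.cobounded2)
    then have 2: "8 * \<delta> \<le> b - a - m * e" by simp
    have 3: "\<delta> > 0" unfolding \<delta>_def using \<open>m * e < b - a\<close> \<open>a < b\<close> by simp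
    have \<delta>: "\<delta> > 0" "m * e < b - a - 4 * \<delta>" "a + 2 * \<delta> < b - 2 * \<delta>"
      using 1 2 3 by linarith+
    \<comment> \<open>The slopes of this trapezoid end at \<open>a + \<delta>\<close> and \<open>b - \<delta>\<close>, inside the open interval.\<close>
    let ?z = "trap (a + 2 * \<delta>) (b - 2 * \<delta>) \<delta>"
    have "b - a - 4 * \<delta> = (\<integral>x. indicator {a + 2 * \<delta>..b - 2 * \<delta>} x \<partial>lborel)"
      using \<delta> by simp
    also have "\<dots> \<le> (\<integral>x. ?z x \<partial>lborel)"
      using trap_ge[OF \<delta>(1)] trap_integrable[OF \<delta>(1)]
      by (intro integral_mono integrable_real_indicator) (auto simp: emeasure_lborel_Icc_eq)
    finally have "e < (\<integral>x. ?z x \<partial>lborel) / m"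
      using \<delta> \<open>m > 0\<close> by (simp add: field_simps)
    with trap_limit[OF \<delta>(1)]
    have "eventually (\<lambda>t. e < enn2real (renewal \<mu> (\<lambda>x. ennreal (?z x)) t)) at_top"
      by (rule order_tendstoD)
    then show "eventually (\<lambda>t. e < enn2real (renewal \<mu> f t)) at_top"
    proof eventually_elim
      case (elim t)
      have "renewal \<mu> (\<lambda>x. ennreal (?z x)) t \<le> renewal \<mu> f t"
      proof (rule renewal_causal_mono)
        fix x
        have "ennreal (?z x) \<le> ennreal (indicator {a + 2 * \<delta> - \<delta>..b - 2 * \<delta> + \<delta>} x)"
          by (intro ennreal_leI trap_le \<delta>)
        also have "\<dots> \<le> indicator {a<..<b} x" using \<delta> by (auto split: split_indicator)
        also have "\<dots> \<le> f x" by (rule lower)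
        finally show "ennreal (?z x) \<le> f x" .
      qed
      moreover have "renewal \<mu> f t < \<infinity>"
        by (rule order.strict_trans1[OF renewal_causal_mono renewal_finite]) (rule upper)
      ultimately have "enn2real (renewal \<mu> (\<lambda>x. ennreal (?z x)) t) \<le> enn2real (renewal \<mu> f t)"
        by (intro enn2real_mono) auto
      then show ?case using elim by simp
    qed
  qed
qed

end

section \<open>The counting function of a perturbed random walk\<close>

locale perturbed_renewal = renewal_law \<mu> + noise: prob_space \<gamma> + noise: halfline_measure \<gamma>
  for \<mu> \<gamma> :: "real measure"
begin

lemma noise_mass: "emeasure \<gamma> UNIV = 1" "measure \<gamma> UNIV = 1"
  using noise.emeasure_space_1 noise.prob_space by simp_all

lemma noise_le:
  assumes "\<And>y. 0 \<le> y \<Longrightarrow> f (t - y) \<le> c"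
  shows "(\<gamma> \<odot> f) t \<le> c"
proof -
  have "(\<gamma> \<odot> f) t \<le> (\<integral>\<^sup>+y. c \<partial>\<gamma>)"
    unfolding conv_fun_def
    by (rule nn_integral_mono_AE) (use noise.AE_nonneg in eventually_elim, auto intro: assms)
  then show ?thesis by (simp add: noise_mass)
qed

lemma counting_finite: "renewal \<mu> (\<gamma> \<odot> heaviside) t < \<infinity>"
proof -
  have "(\<gamma> \<odot> renewal \<mu> heaviside) t \<le> renewal \<mu> heaviside t"
  proof (rule noise_le)
    fix y :: real assume "0 \<le> y"
    have "renewal \<mu> heaviside (t - y) = renewal \<mu> (\<lambda>x. heaviside (x + - y)) t"
      using renewal_shift[of heaviside "- y" t] by simp
    also have "\<dots> \<le> renewal \<mu> heaviside t"
      using \<open>0 \<le> y\<close> by (intro renewal_causal_mono) (auto split: split_indicator)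
    finally show "renewal \<mu> heaviside (t - y) \<le> renewal \<mu> heaviside t" .
  qed
  then show ?thesis
    using renewal_heaviside_finite[of t]
    by (simp add: renewal_commute[OF noise.sigma_finite_borel_axioms])
qed

lemma window_bounded:
  obtains C where "C < \<infinity>" "\<And>t. renewal \<mu> (indicator {- s..<0}) t \<le> C"
proof -
  obtain C where C: "C < \<infinity>" "\<And>t. renewal \<mu> (indicator {- s..- s + s}) t \<le> C"
    using renewal_interval_bounded[of s] by blast
  have "renewal \<mu> (indicator {- s..<0}) t \<le> C" for t
    by (rule order_trans[OF renewal_causal_mono C(2)]) (auto split: split_indicator)
  then show ?thesis using that C by blast
qed

text \<open>The perturbation commutes with the renewal operator, so the increments of the counting
  function are those of the unperturbed renewal function, averaged over the noise. Both their
  boundedness and their limit carry over.\<close>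

lemma counting_increment:
  assumes "s \<ge> 0"
  shows "enn2real (renewal \<mu> (\<gamma> \<odot> heaviside) (t + s)) = enn2real (renewal \<mu> (\<gamma> \<odot> heaviside) t)
    + (\<integral>y. enn2real (renewal \<mu> (indicator {- s..<0}) (t - y)) \<partial>\<gamma>)"
proof -
  let ?I = "indicator {- s..<0} :: real \<Rightarrow> ennreal"
  obtain C where C: "C < \<infinity>" "\<And>t. renewal \<mu> ?I t \<le> C" by (rule window_bounded) blast
  have fin: "renewal \<mu> ?I t < \<infinity>" for t by (rule order.strict_trans1[OF C(2,1)])
  have fin': "(\<gamma> \<odot> renewal \<mu> ?I) t < \<infinity>"
    using noise_le[of "renewal \<mu> ?I" t C] C by (simp add: order.strict_trans1)
  have "renewal \<mu> (\<gamma> \<odot> heaviside) (t + s) = renewal \<mu> (\<gamma> \<odot> (\<lambda>x. heaviside (x + s))) t"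
    by (simp add: noise.conv_shift[of heaviside] renewal_shift[of "\<gamma> \<odot> heaviside"])
  also have "(\<lambda>x. heaviside (x + s)) = (\<lambda>x. heaviside x + ?I x)"
    using assms by (auto simp: fun_eq_iff split: split_indicator)
  also have "renewal \<mu> (\<gamma> \<odot> (\<lambda>x. heaviside x + ?I x)) t
      = renewal \<mu> (\<gamma> \<odot> heaviside) t + renewal \<mu> (\<gamma> \<odot> ?I) t"
    by (simp add: noise.conv_add renewal_add)
  also have "renewal \<mu> (\<gamma> \<odot> ?I) t = (\<gamma> \<odot> renewal \<mu> ?I) t"
    by (simp add: renewal_commute[OF noise.sigma_finite_borel_axioms])
  finally have "enn2real (renewal \<mu> (\<gamma> \<odot> heaviside) (t + s)) =
      enn2real (renewal \<mu> (\<gamma> \<odot> heaviside) t) + enn2real ((\<gamma> \<odot> renewal \<mu> ?I) t)"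
    using counting_finite[of t] fin' by (simp add: enn2real_plus)
  also have "(\<gamma> \<odot> renewal \<mu> ?I) t = (\<integral>\<^sup>+y. ennreal (enn2real (renewal \<mu> ?I (t - y))) \<partial>\<gamma>)"
    using fin by (simp add: conv_fun_def)
  also have "enn2real \<dots> = (\<integral>y. enn2real (renewal \<mu> ?I (t - y)) \<partial>\<gamma>)"
    by (rule integral_eq_nn_integral[symmetric]) auto
  finally show ?thesis .
qed

lemma counting_increment_bounded:
  assumes "s \<ge> 0"
  obtains C where "\<And>t. enn2real (renewal \<mu> (\<gamma> \<odot> heaviside) (t + s)) \<le> enn2real (renewal \<mu> (\<gamma> \<odot> heaviside) t) + C"
proof -
  let ?I = "indicator {- s..<0} :: real \<Rightarrow> ennreal"
  obtain C where C: "C < \<infinity>" "\<And>t. renewal \<mu> ?I t \<le> C" by (rule window_bounded) blast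
  have le: "enn2real (renewal \<mu> ?I x) \<le> enn2real C" for x
    using C by (intro enn2real_mono) auto
  have "(\<integral>y. enn2real (renewal \<mu> ?I (t - y)) \<partial>\<gamma>) \<le> enn2real C" for t
  proof -
    have "(\<integral>y. enn2real (renewal \<mu> ?I (t - y)) \<partial>\<gamma>) \<le> (\<integral>y. enn2real C \<partial>\<gamma>)"
      using le by (intro integral_mono noise.integrable_const_bound[where B = "enn2real C"]) auto
    then show ?thesis by (simp add: noise_mass)
  qed
  then show ?thesis using that[of "enn2real C"] by (simp add: counting_increment[OF assms])
qed

lemma counting_increment_limit:
  assumes "nonlattice \<mu>" "integrable \<mu> (\<lambda>y. y)" "s > 0"
  shows "((\<lambda>t. enn2real (renewal \<mu> (\<gamma> \<odot> heaviside) (t + s)) - enn2real (renewal \<mu> (\<gamma> \<odot> heaviside) t))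
    \<longlongrightarrow> s / (\<integral>y. y \<partial>\<mu>)) at_top"
proof -
  let ?I = "indicator {- s..<0} :: real \<Rightarrow> ennreal"
  let ?R = "\<lambda>t. enn2real (renewal \<mu> ?I t)"
  obtain C where C: "C < \<infinity>" "\<And>t. renewal \<mu> ?I t \<le> C" by (rule window_bounded) blast
  have le: "?R x \<le> enn2real C" for x
    using C by (intro enn2real_mono) auto
  have R_lim: "(?R \<longlongrightarrow> s / (\<integral>y. y \<partial>\<mu>)) at_top"
    using blackwell[OF assms(1,2), of "- s" 0 ?I] assms(3) by (auto split: split_indicator)
  have "((\<lambda>t. \<integral>y. ?R (t - y) \<partial>\<gamma>) \<longlongrightarrow> (\<integral>y. s / (\<integral>y. y \<partial>\<mu>) \<partial>\<gamma>)) at_top"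
  proof (rule integral_dominated_convergence_at_top[where w = "\<lambda>_. enn2real C"])
    show "AE y in \<gamma>. ((\<lambda>t. ?R (t - y)) \<longlongrightarrow> s / (\<integral>y. y \<partial>\<mu>)) at_top"
    proof (rule AE_I2)
      fix y :: real
      have "filterlim (\<lambda>t. - y + t) at_top at_top"
        by (rule filterlim_tendsto_add_at_top[OF tendsto_const filterlim_ident])
      from filterlim_compose[OF R_lim this] show "((\<lambda>t. ?R (t - y)) \<longlongrightarrow> s / (\<integral>y. y \<partial>\<mu>)) at_top" by simp
    qed
    show "\<forall>\<^sub>F t in at_top. AE y in \<gamma>. norm (?R (t - y)) \<le> enn2real C"
      using le by (intro always_eventually allI AE_I2) auto
  qed auto
  then show ?thesis
    using assms(3) by (simp add: counting_increment noise_mass)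
qed

end

section \<open>Stieltjes convolution powers\<close>

locale stieltjes_function =
  fixes V :: "real \<Rightarrow> real"
  assumes V_mono: "\<And>x y. x \<le> y \<Longrightarrow> V x \<le> V y"
    and V_right_cont: "\<And>x. continuous (at_right x) V"
    and V_neg: "\<And>x. x < 0 \<Longrightarrow> V x = 0"
begin

abbreviation \<nu> :: "real measure" where "\<nu> \<equiv> interval_measure V"

lemma V_nonneg: "0 \<le> V x"
  using V_mono[of "min x (-1)" x] V_neg[of "min x (-1)"] by simp

text \<open>As \<open>V\<close> vanishes to the left of \<open>0\<close>, there is no mass there; the value \<open>V 0\<close> is the mass of
  the point \<open>0\<close>.\<close>

lemma emeasure_Iic: "emeasure \<nu> {..x} = ennreal (V x)"
proof -
  have "emeasure \<nu> {..x} = emeasure \<nu> {min x (-1) - 1<..x} + emeasure \<nu> {..min x (-1) - 1}"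
    by (subst plus_emeasure) (auto intro!: arg_cong[where f = "emeasure \<nu>"])
  moreover have "emeasure \<nu> {..y} = 0" if "y < 0" for y
  proof -
    have "emeasure \<nu> (\<Union>n::nat. {y - real n - 1<..y - real n}) = 0"
    proof (rule emeasure_UN_eq_0)
      show "emeasure \<nu> {y - real n - 1<..y - real n} = 0" for n
        using that by (subst emeasure_interval_measure_Ioc) (auto simp: V_mono V_right_cont V_neg)
    qed auto
    moreover have "(\<Union>n::nat. {y - real n - 1<..y - real n}) = {..y}"
    proof (intro equalityI subsetI)
      fix z assume "z \<in> {..y}"
      define n where "n = nat \<lfloor>y - z\<rfloor>"
      have "real n \<le> y - z" "y - z < real n + 1"
        using \<open>z \<in> {..y}\<close> unfolding n_def by auto
      then show "z \<in> (\<Union>n::nat. {y - real n - 1<..y - real n})" by (intro UN_I[of n]) auto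
    qed auto
    ultimately show ?thesis by simp
  qed
  moreover have "emeasure \<nu> {min x (-1) - 1<..x} = ennreal (V x - V (min x (-1) - 1))"
    by (rule emeasure_interval_measure_Ioc) (auto simp: V_mono V_right_cont)
  moreover have "V (min x (-1) - 1) = 0" by (rule V_neg) auto
  ultimately show ?thesis by simp
qed

sublocale halfline_measure \<nu>
proof -
  interpret sigma_finite_measure \<nu>
    by (rule sigma_finite_interval_measure) (auto simp: V_mono V_right_cont)
  show "halfline_measure \<nu>"
  proof
    have "(\<Union>n::nat. {..- inverse (real (Suc n))}) \<in> null_sets \<nu>"
      by (intro null_sets_UN) (auto simp: null_sets_def emeasure_Iic V_neg)
    moreover have "{x. \<not> 0 \<le> x} \<subseteq> (\<Union>n::nat. {..- inverse (real (Suc n))})"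
    proof
      fix x :: real assume "x \<in> {x. \<not> 0 \<le> x}"
      then obtain n where "inverse (real (Suc n)) < - x" using reals_Archimedean[of "- x"] by auto
      then show "x \<in> (\<Union>n::nat. {..- inverse (real (Suc n))})" by (intro UN_I[of n]) auto
    qed
    ultimately show "AE x in \<nu>. 0 \<le> x" by (intro AE_I') auto
  qed simp
qed

abbreviation W :: "nat \<Rightarrow> real \<Rightarrow> ennreal" where "W n \<equiv> conv_iter \<nu> n heaviside"

abbreviation v :: "nat \<Rightarrow> real \<Rightarrow> real" where "v \<equiv> ls_conv_power V"

lemma W_1: "W 1 t = ennreal (V t)"
  by (simp add: conv_heaviside emeasure_Iic)

lemma W_neg: "t < 0 \<Longrightarrow> W n t = 0"
  by (rule conv_iter_eq_0) auto

lemma W_mono: "s \<le> t \<Longrightarrow> W n s \<le> W n t"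
  using conv_iter_causal_mono[of s heaviside "\<lambda>x. heaviside (x + (t - s))" n]
  by (auto simp: conv_iter_shift[of n heaviside] split: split_indicator)

lemma W_finite: "W n t < \<infinity>"
proof (induction n arbitrary: t)
  case (Suc n)
  have "W (Suc n) t \<le> (\<integral>\<^sup>+y. W n t * indicator {..t} y \<partial>\<nu>)"
    unfolding conv_iter_Suc
  proof (rule nn_integral_mono_AE, use AE_nonneg in eventually_elim)
    fix y :: real assume "0 \<le> y"
    then show "W n (t - y) \<le> W n t * indicator {..t} y"
      using W_mono[of "t - y" t n] W_neg[of "t - y" n] by (auto split: split_indicator)
  qed
  also have "\<dots> = W n t * ennreal (V t)"
    by (simp add: nn_integral_cmult emeasure_Iic)
  also have "\<dots> < \<infinity>"
    using Suc by (simp add: ennreal_mult_less_top)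
  finally show ?case .
qed (auto split: split_indicator)

text \<open>Restricting the integral to \<open>{0..t}\<close> changes nothing, because the iterates vanish on the
  negative half-line and the measure does not charge it.\<close>

lemma v_eq_W: "v n t = enn2real (W n t)"
proof (induction n arbitrary: t)
  case 0
  then show ?case by (auto split: split_indicator)
next
  case (Suc n)
  show ?case
  proof (cases n)
    case 0
    then show ?thesis using W_1 V_nonneg by simp
  next
    case (Suc k)
    have "v (Suc n) t = (\<integral>y. indicator {0..t} y * enn2real (W n (t - y)) \<partial>\<nu>)"
      using Suc.IH by (simp add: \<open>n = Suc k\<close> set_lebesgue_integral_def)
    also have "\<dots> = enn2real (\<integral>\<^sup>+y. ennreal (indicator {0..t} y * enn2real (W n (t - y))) \<partial>\<nu>)"
      by (rule integral_eq_nn_integral) auto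
    also have "(\<integral>\<^sup>+y. ennreal (indicator {0..t} y * enn2real (W n (t - y))) \<partial>\<nu>) = W (Suc n) t"
      unfolding conv_iter_Suc
    proof (rule nn_integral_cong_AE, use AE_nonneg in eventually_elim)
      fix y :: real assume "0 \<le> y"
      then show "ennreal (indicator {0..t} y * enn2real (W n (t - y))) = W n (t - y)"
        using W_finite[of n "t - y"] W_neg[of "t - y" n] by (auto split: split_indicator)
    qed
    finally show ?thesis .
  qed
qed

lemma ennreal_v: "ennreal (v n t) = W n t"
  using W_finite[of n t] by (simp add: v_eq_W)

lemma v_nonneg: "0 \<le> v n t"
  by (simp add: v_eq_W)

lemma v_mono: "s \<le> t \<Longrightarrow> v n s \<le> v n t"
  unfolding v_eq_W by (intro enn2real_mono W_mono W_finite[unfolded infinity_ennreal_def])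

lemma conv_iter_W_shift:
  "conv_iter \<nu> n (\<lambda>x. W k (x + s)) t = ennreal (v (n + k) (t + s))"
  by (simp add: conv_iter_shift[of n "W k"] ennreal_v funpow_add)

text \<open>Convolution is additive, homogeneous, monotone and commutes with shifts. The numbers of
  terms are those needed below; zero coefficients cover shorter combinations.\<close>

lemma lift_inequality:
  assumes "a1 \<ge> 0" "a2 \<ge> 0" "b1 \<ge> 0" "b2 \<ge> 0" "b3 \<ge> 0"
    and le: "\<And>x. a1 * v k1 (x + s1) + a2 * v k2 (x + s2)
      \<le> b1 * v l1 (x + u1) + b2 * v l2 (x + u2) + b3 * v l3 (x + u3)"
  shows "a1 * v (n + k1) (t + s1) + a2 * v (n + k2) (t + s2)
      \<le> b1 * v (n + l1) (t + u1) + b2 * v (n + l2) (t + u2) + b3 * v (n + l3) (t + u3)"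
proof -
  let ?L = "\<lambda>x. ennreal a1 * W k1 (x + s1) + ennreal a2 * W k2 (x + s2)"
  let ?R = "\<lambda>x. ennreal b1 * W l1 (x + u1) + ennreal b2 * W l2 (x + u2) + ennreal b3 * W l3 (x + u3)"
  have "conv_iter \<nu> n ?L t \<le> conv_iter \<nu> n ?R t"
  proof (rule conv_iter_causal_mono)
    fix x
    have "?L x = ennreal (a1 * v k1 (x + s1) + a2 * v k2 (x + s2))"
      using assms(1-5) by (simp add: ennreal_v[symmetric] ennreal_mult[symmetric] v_nonneg ennreal_plus[symmetric] del: ennreal_plus)
    also have "\<dots> \<le> ennreal (b1 * v l1 (x + u1) + b2 * v l2 (x + u2) + b3 * v l3 (x + u3))"
      by (intro ennreal_leI le)
    also have "\<dots> = ?R x"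
      using assms(1-5) by (simp add: ennreal_v[symmetric] ennreal_mult[symmetric] v_nonneg ennreal_plus[symmetric] del: ennreal_plus)
    finally show "?L x \<le> ?R x" .
  qed
  also have "conv_iter \<nu> n ?L t = ennreal (a1 * v (n + k1) (t + s1) + a2 * v (n + k2) (t + s2))"
    using assms(1-5)
    by (simp add: conv_iter_add conv_iter_cmult conv_iter_W_shift ennreal_mult[symmetric] v_nonneg
        ennreal_plus[symmetric] del: ennreal_plus)
  also have "conv_iter \<nu> n ?R t = ennreal (b1 * v (n + l1) (t + u1) + b2 * v (n + l2) (t + u2) + b3 * v (n + l3) (t + u3))"
    using assms(1-5)
    by (simp add: conv_iter_add conv_iter_cmult conv_iter_W_shift ennreal_mult[symmetric] v_nonneg
        ennreal_plus[symmetric] del: ennreal_plus)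
  finally show ?thesis
    using assms(1-5) by (subst (asm) ennreal_le_iff) (auto intro!: add_nonneg_nonneg mult_nonneg_nonneg v_nonneg)
qed

text \<open>As a density, the coercion \<open>ennreal\<close> is the positive part of the identity; on the half-line
  this is the first-moment measure \<open>y \<nu>(dy)\<close>.\<close>

abbreviation \<nu>1 :: "real measure" where "\<nu>1 \<equiv> density \<nu> ennreal"

lemma sigma_finite_borel_\<nu>1: "sigma_finite_borel \<nu>1"
proof -
  have "sigma_finite_measure \<nu>1"
    by (subst sigma_finite_iff_density_finite) auto
  then show ?thesis
    by (simp add: sigma_finite_borel_def sigma_finite_borel_axioms_def)
qed

text \<open>The product rule for convolution, from \<open>t = (t - y) + y\<close>.\<close>

lemma mult_conv:
  assumes [measurable]: "f \<in> borel_measurable borel" and neg: "\<And>x. x < 0 \<Longrightarrow> f x = 0"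
  shows "ennreal t * (\<nu> \<odot> f) t = (\<nu> \<odot> (\<lambda>x. ennreal x * f x)) t + (\<nu>1 \<odot> f) t"
proof -
  have "ennreal t * (\<nu> \<odot> f) t = (\<integral>\<^sup>+y. ennreal t * f (t - y) \<partial>\<nu>)"
    unfolding conv_fun_def by (rule nn_integral_cmult[symmetric]) simp
  also have "\<dots> = (\<integral>\<^sup>+y. ennreal (t - y) * f (t - y) + ennreal y * f (t - y) \<partial>\<nu>)"
  proof (rule nn_integral_cong_AE, use AE_nonneg in eventually_elim)
    fix y :: real assume "0 \<le> y"
    show "ennreal t * f (t - y) = ennreal (t - y) * f (t - y) + ennreal y * f (t - y)"
    proof (cases "y \<le> t")
      case True
      then have "ennreal t = ennreal (t - y) + ennreal y"
        using \<open>0 \<le> y\<close> by (simp add: ennreal_plus[symmetric] del: ennreal_plus)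
      then show ?thesis by (simp add: distrib_right)
    qed (simp add: neg)
  qed
  also have "\<dots> = (\<nu> \<odot> (\<lambda>x. ennreal x * f x)) t + (\<nu>1 \<odot> f) t"
    by (simp add: nn_integral_add conv_fun_def nn_integral_density)
  finally show ?thesis .
qed

text \<open>Iterating the product rule splits \<open>t\<close> into the slack, given by the iterated convolution of
  the ramp function \<open>ennreal\<close>, and \<open>n + 1\<close> equal contributions of the individual factors.\<close>

lemma moment_identity:
  "ennreal t * W (Suc n) t = conv_iter \<nu> (Suc n) ennreal t + of_nat (Suc n) * (\<nu>1 \<odot> W n) t"
proof (induction n arbitrary: t)
  case 0
  have "\<nu> \<odot> (\<lambda>x. ennreal x * heaviside x) = \<nu> \<odot> ennreal"
    by (rule arg_cong[where f = "(\<odot>) \<nu>"]) (auto simp: fun_eq_iff ennreal_neg split: split_indicator)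
  then show ?case
    using mult_conv[of heaviside t] by simp
next
  case (Suc n)
  interpret \<nu>1: sigma_finite_borel \<nu>1 by (rule sigma_finite_borel_\<nu>1)
  have "ennreal t * W (Suc (Suc n)) t =
      (\<nu> \<odot> (\<lambda>x. ennreal x * W (Suc n) x)) t + (\<nu>1 \<odot> W (Suc n)) t"
    using mult_conv[of "W (Suc n)" t] by (simp add: W_neg del: funpow.simps) (simp add: W_neg)
  also have "\<nu> \<odot> (\<lambda>x. ennreal x * W (Suc n) x) =
      \<nu> \<odot> (\<lambda>x. conv_iter \<nu> (Suc n) ennreal x + of_nat (Suc n) * (\<nu>1 \<odot> W n) x)"
    by (simp only: Suc.IH)
  also have "\<dots> = (\<lambda>x. conv_iter \<nu> (Suc (Suc n)) ennreal x + of_nat (Suc n) * (\<nu> \<odot> (\<nu>1 \<odot> W n)) x)"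
    by (subst conv_add) (auto simp: conv_cmult simp del: of_nat_Suc)
  also have "\<nu> \<odot> (\<nu>1 \<odot> W n) = \<nu>1 \<odot> W (Suc n)"
    by (subst conv_commute) (auto intro: sigma_finite_borel_\<nu>1 sigma_finite_borel_axioms)
  finally show ?case by (simp add: algebra_simps)
qed

end

section \<open>Ratios of consecutive convolution powers\<close>

locale blackwell_function = stieltjes_function +
  fixes m :: real
  assumes m_pos: "0 < m"
    and increment_bounded: "\<And>s. \<exists>C. \<forall>x. V (x + s) \<le> V x + C"
    and increment_limit: "\<And>s. 0 < s \<Longrightarrow> ((\<lambda>x. V (x + s) - V x) \<longlongrightarrow> s / m) at_top"
begin

lemma increment_bounded_pos:
  obtains C where "C > 0" "\<And>x. V (x + s) \<le> V x + C"
proof -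
  obtain C where "\<And>x. V (x + s) \<le> V x + C" using increment_bounded by blast
  then have "V (x + s) \<le> V x + max 1 C" for x
    by (meson add_left_mono max.cobounded2 order_trans)
  then show ?thesis using that[of "max 1 C"] by simp
qed

lemma linear_lower_bound:
  obtains c d where "c > 0" "d \<ge> 0" "\<And>x. c * x \<le> V x + d"
proof -
  define c where "c = 1 / (2 * m)"
  have c: "c > 0" "c < 1 / m" using m_pos by (auto simp: c_def field_simps)
  have "eventually (\<lambda>x. c < V (x + 1) - V x) at_top"
    using increment_limit[of 1] c by (intro order_tendstoD) auto
  then obtain T0 where T0: "\<And>x. x \<ge> T0 \<Longrightarrow> c < V (x + 1) - V x"
    by (auto simp: eventually_at_top_linorder)
  define T where "T = max 0 T0"
  have T: "T \<ge> 0" "\<And>x. x \<ge> T \<Longrightarrow> c < V (x + 1) - V x" using T0 by (auto simp: T_def)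
  have step: "c * real n \<le> V (T + real n)" for n
  proof (induction n)
    case (Suc n)
    then show ?case using T(2)[of "T + real n"] by (simp add: algebra_simps)
  qed (simp add: V_nonneg)
  have "c * x \<le> V x + c * (T + 1)" for x
  proof (cases "x \<ge> T")
    case True
    define n where "n = nat \<lfloor>x - T\<rfloor>"
    have n: "real n \<le> x - T" "x - T < real n + 1" using True by (auto simp: n_def)
    have "c * (x - T) \<le> c * (real n + 1)" using n c by (intro mult_left_mono) auto
    also have "\<dots> \<le> V (T + real n) + c" using step[of n] by (simp add: algebra_simps)
    also have "V (T + real n) \<le> V x" using n by (intro V_mono) simp
    finally show ?thesis by (simp add: algebra_simps)
  next
    case False
    then have "c * x \<le> c * (T + 1)" using c by (intro mult_left_mono) auto
    then show ?thesis using V_nonneg[of x] by simp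
  qed
  then show ?thesis using that[of c "c * (T + 1)"] c T by simp
qed

lemma linear_upper_bound:
  obtains C where "C > 0" "\<And>x. x \<ge> 0 \<Longrightarrow> V x \<le> C * (x + 1)"
proof -
  obtain C where C: "C > 0" "\<And>x. V (x + 1) \<le> V x + C"
    by (rule increment_bounded_pos) blast
  have step: "V (y + real n) \<le> C * (real n + 1)" if "y < 1" for y n
  proof (induction n)
    case 0
    have "V y \<le> V (y - 1) + C" using C(2)[of "y - 1"] by simp
    then show ?case using that by (simp add: V_neg)
  next
    case (Suc n)
    then show ?case using C(2)[of "y + real n"] by (simp add: algebra_simps)
  qed
  have "V x \<le> C * (x + 1)" if "x \<ge> 0" for x
  proof -
    define n where "n = nat \<lfloor>x\<rfloor>"
    have n: "real n \<le> x" "x < real n + 1" using that by (auto simp: n_def)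
    have "V x = V ((x - real n) + real n)" by simp
    also have "\<dots> \<le> C * (real n + 1)" using n by (intro step) simp
    also have "\<dots> \<le> C * (x + 1)" using n C by (intro mult_left_mono) auto
    finally show ?thesis .
  qed
  then show ?thesis using that C by blast
qed

text \<open>For a single factor the mean slack in \<open>[0, R]\<close> is at least a fixed fraction of the mean
  position, up to an additive constant, because by linear growth the half interval \<open>[0, R/2]\<close>
  carries a fixed fraction of the mass of \<open>[0, R]\<close>.\<close>

lemma slack_dominates_moment:
  obtains \<delta> R0 where "\<delta> > 0" "R0 \<ge> 0"
    "\<And>t. ennreal \<delta> * (\<nu>1 \<odot> heaviside) t \<le> (\<nu> \<odot> ennreal) t + ennreal (\<delta> * R0) * W 1 t"
proof -
  obtain c d where c: "c > 0" "d \<ge> 0" "\<And>x. c * x \<le> V x + d" by (rule linear_lower_bound) blast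
  obtain C where C: "C > 0" "\<And>x. x \<ge> 0 \<Longrightarrow> V x \<le> C * (x + 1)" by (rule linear_upper_bound) blast
  \<comment> \<open>For \<open>t \<ge> R0\<close> the bounds give \<open>V (t / 2) \<ge> c * t / 4\<close> and \<open>V t \<le> 2 * C * t\<close>,
     hence \<open>V (t / 2) \<ge> 2 * \<delta> * V t\<close>.\<close>
  define \<delta> where "\<delta> = c / (16 * C)"
  define R0 where "R0 = max 1 (4 * d / c)"
  have \<delta>: "\<delta> > 0" using c C by (simp add: \<delta>_def)
  have R0: "R0 \<ge> 1" "R0 \<ge> 4 * d / c" by (auto simp: R0_def)
  have moment: "(\<nu>1 \<odot> heaviside) t \<le> ennreal (t * V t)" for t
  proof (cases "t \<ge> 0")
    case True
    have "(\<nu>1 \<odot> heaviside) t \<le> (\<integral>\<^sup>+y. ennreal t * indicator {..t} y \<partial>\<nu>)"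
      unfolding conv_fun_def[of \<nu>1]
      by (subst nn_integral_density) (auto intro!: nn_integral_mono ennreal_leI split: split_indicator)
    also have "\<dots> = ennreal (t * V t)"
      using True V_nonneg by (simp add: nn_integral_cmult emeasure_Iic ennreal_mult)
    finally show ?thesis .
  next
    case False
    have "(\<nu>1 \<odot> heaviside) t = (\<integral>\<^sup>+y. ennreal y * heaviside (t - y) \<partial>\<nu>)"
      by (simp add: conv_fun_def nn_integral_density)
    also have "\<dots> = (\<integral>\<^sup>+y. 0 \<partial>\<nu>)"
      using False by (intro nn_integral_cong) (auto simp: ennreal_neg split: split_indicator)
    finally have "(\<nu>1 \<odot> heaviside) t = 0" by simp
    then show ?thesis by simp
  qed
  have slack: "ennreal (t / 2 * V (t / 2)) \<le> (\<nu> \<odot> ennreal) t" if "t \<ge> 0" for t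
  proof -
    have "ennreal (t / 2 * V (t / 2)) = (\<integral>\<^sup>+y. ennreal (t / 2) * indicator {..t / 2} y \<partial>\<nu>)"
      using that V_nonneg by (simp add: nn_integral_cmult emeasure_Iic ennreal_mult[symmetric])
    also have "\<dots> \<le> (\<nu> \<odot> ennreal) t"
      unfolding conv_fun_def by (intro nn_integral_mono) (auto intro!: ennreal_leI split: split_indicator)
    finally show ?thesis .
  qed
  have "ennreal \<delta> * (\<nu>1 \<odot> heaviside) t \<le> (\<nu> \<odot> ennreal) t + ennreal (\<delta> * R0) * W 1 t" for t
  proof (cases "t < R0")
    case True
    have "ennreal \<delta> * (\<nu>1 \<odot> heaviside) t \<le> ennreal \<delta> * ennreal (t * V t)"
      by (intro mult_left_mono moment) simp
    also have "\<dots> \<le> ennreal \<delta> * ennreal (R0 * V t)"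
      using True V_nonneg[of t] by (intro mult_left_mono ennreal_leI mult_right_mono) auto
    also have "\<dots> = ennreal (\<delta> * R0) * W 1 t"
      using \<delta> R0 V_nonneg[of t] unfolding W_1 by (simp add: ennreal_mult mult.assoc)
    finally show ?thesis by (simp add: add_increasing)
  next
    case False
    then have t: "t \<ge> R0" "t \<ge> 1" using R0 by auto
    have "4 * d / c \<le> t" using t R0 by linarith
    then have "d \<le> c * t / 4" using c by (simp add: field_simps)
    moreover have "c * (t / 2) \<le> V (t / 2) + d" by (rule c(3))
    ultimately have "c * t / 4 \<le> V (t / 2)" by (simp add: field_simps)
    moreover have "V t \<le> 2 * C * t"
    proof -
      have "V t \<le> C * (t + 1)" using t by (intro C(2)) simp
      also have "\<dots> \<le> C * (2 * t)" using t C by (intro mult_left_mono) auto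
      finally show ?thesis by simp
    qed
    then have "2 * \<delta> * V t \<le> 2 * \<delta> * (2 * C * t)" using \<delta> by (intro mult_left_mono) auto
    moreover have "2 * \<delta> * (2 * C * t) = c * t / 4" using C by (simp add: \<delta>_def field_simps)
    ultimately have "2 * \<delta> * V t \<le> V (t / 2)" by linarith
    then have "t / 2 * (2 * \<delta> * V t) \<le> t / 2 * V (t / 2)" using t by (intro mult_left_mono) auto
    then have "\<delta> * (t * V t) \<le> t / 2 * V (t / 2)" by (simp add: algebra_simps)
    have "ennreal \<delta> * (\<nu>1 \<odot> heaviside) t \<le> ennreal \<delta> * ennreal (t * V t)"
      by (intro mult_left_mono moment) simp
    also have "\<dots> = ennreal (\<delta> * (t * V t))"
      using \<delta> t V_nonneg[of t] by (simp add: ennreal_mult)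
    also have "\<dots> \<le> ennreal (t / 2 * V (t / 2))" by (rule ennreal_leI) fact
    also have "\<dots> \<le> (\<nu> \<odot> ennreal) t" using t by (intro slack) simp
    finally show ?thesis by (simp add: add_increasing2)
  qed
  then show ?thesis using that[of \<delta> R0] \<delta> R0 by simp
qed

text \<open>Given that the sum of \<open>n + 1\<close> factors is at most \<open>t\<close>, symmetry and the previous lemma show
  that on average the slack is of order at least \<open>t / (n + 1)\<close>. A further factor can be placed
  anywhere within the slack, which yields the ratio of consecutive powers.\<close>

lemma power_ratio:
  obtains \<alpha> \<beta> where "\<alpha> > 0" "\<And>n t. t \<ge> 0 \<Longrightarrow> (\<alpha> * t / real (Suc n) - \<beta>) * v n t \<le> v (Suc n) t"
proof -
  obtain c d where c: "c > 0" "d \<ge> 0" "\<And>x. c * x \<le> V x + d" by (rule linear_lower_bound) blast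
  obtain \<delta> R0 where \<delta>: "\<delta> > 0" "R0 \<ge> 0"
    "\<And>t. ennreal \<delta> * (\<nu>1 \<odot> heaviside) t \<le> (\<nu> \<odot> ennreal) t + ennreal (\<delta> * R0) * W 1 t"
    by (rule slack_dominates_moment) blast
  interpret \<nu>1: sigma_finite_borel \<nu>1 by (rule sigma_finite_borel_\<nu>1)
  define \<kappa> where "\<kappa> = \<delta> / (1 + \<delta>)"
  have \<kappa>: "\<kappa> > 0" "\<kappa> \<le> 1" using \<delta> by (auto simp: \<kappa>_def)
  have succ: "(c * \<kappa> * (t / real (Suc k) - R0) - d) * v (Suc k) t \<le> v (Suc (Suc k)) t"
    if "t \<ge> 0" for t k
  proof -
    \<comment> \<open>\<open>I\<close> and \<open>E\<close> are the total slack and the total position of one factor. Eliminating \<open>E\<close>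
       from the moment identity and the previous lemma bounds \<open>I\<close> from below.\<close>
    define I where "I = conv_iter \<nu> (Suc k) ennreal t"
    define E where "E = (\<nu>1 \<odot> W k) t"
    let ?w = "v (Suc k) t"
    have identity: "ennreal (t * ?w) = I + of_nat (Suc k) * E"
      using moment_identity[of t k] that by (simp add: I_def E_def ennreal_v[symmetric] ennreal_mult v_nonneg del: funpow.simps ls_conv_power.simps)
    have "I \<le> ennreal (t * ?w)" unfolding identity by simp
    then obtain i where i: "I = ennreal i" "i \<ge> 0"
      by (metis ennreal_cases ennreal_less_top infinity_ennreal_def leD)
    have "E \<le> of_nat (Suc k) * E"
      using mult_right_mono[of 1 "of_nat (Suc k)" E] by simp
    also have "\<dots> \<le> ennreal (t * ?w)" unfolding identity by simp
    finally obtain e where e: "E = ennreal e" "e \<ge> 0"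
      by (metis ennreal_cases ennreal_less_top infinity_ennreal_def leD)
    have 1: "t * ?w = i + real (Suc k) * e"
    proof -
      have "ennreal (t * ?w) = ennreal (i + real (Suc k) * e)"
        unfolding identity i e using i(2) e(2)
        by (simp add: ennreal_plus ennreal_mult ennreal_of_nat_eq_real_of_nat del: of_nat_Suc)
      then show ?thesis
        using that i(2) e(2) by (subst (asm) ennreal_inj) (auto intro!: mult_nonneg_nonneg add_nonneg_nonneg v_nonneg)
    qed
    have 2: "\<delta> * e \<le> i + \<delta> * R0 * ?w"
    proof -
      have "conv_iter \<nu> k (\<lambda>x. ennreal \<delta> * (\<nu>1 \<odot> heaviside) x) t
          \<le> conv_iter \<nu> k (\<lambda>x. (\<nu> \<odot> ennreal) x + ennreal (\<delta> * R0) * W 1 x) t"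
        by (intro conv_iter_causal_mono \<delta>)
      also have "conv_iter \<nu> k (\<lambda>x. ennreal \<delta> * (\<nu>1 \<odot> heaviside) x) t = ennreal \<delta> * E"
        using conv_iter_commute[OF sigma_finite_borel_axioms sigma_finite_borel_\<nu>1, of heaviside k]
        by (simp add: conv_iter_cmult E_def)
      also have "conv_iter \<nu> k (\<lambda>x. (\<nu> \<odot> ennreal) x + ennreal (\<delta> * R0) * W 1 x) t
          = I + ennreal (\<delta> * R0) * W (Suc k) t"
        by (simp add: conv_iter_add conv_iter_cmult I_def funpow_swap1)
      also have "\<dots> = ennreal (i + \<delta> * R0 * ?w)"
        using i \<delta> by (simp add: ennreal_v[symmetric] ennreal_plus ennreal_mult v_nonneg del: funpow.simps ls_conv_power.simps)
      also have "ennreal \<delta> * E = ennreal (\<delta> * e)" using e \<delta> by (simp add: ennreal_mult)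
      finally show ?thesis
        using i \<delta> by (subst (asm) ennreal_le_iff) (auto intro!: mult_nonneg_nonneg add_nonneg_nonneg v_nonneg)
    qed
    have power_W: "conv_iter \<nu> (Suc k) (W 1) = W (Suc (Suc k))"
      by (simp add: funpow_swap1)
    have 3: "c * i \<le> v (Suc (Suc k)) t + d * ?w"
    proof -
      have "conv_iter \<nu> (Suc k) (\<lambda>x. ennreal c * ennreal x) t
          \<le> conv_iter \<nu> (Suc k) (\<lambda>x. W 1 x + ennreal d * heaviside x) t"
      proof (rule conv_iter_causal_mono)
        fix x
        show "ennreal c * ennreal x \<le> W 1 x + ennreal d * heaviside x"
        proof (cases "x \<ge> 0")
          case True
          have "ennreal c * ennreal x = ennreal (c * x)" using True c by (simp add: ennreal_mult)
          also have "\<dots> \<le> ennreal (V x + d)" by (intro ennreal_leI c)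
          also have "\<dots> = W 1 x + ennreal d * heaviside x"
            unfolding W_1 using True V_nonneg c by (simp add: ennreal_plus)
          finally show ?thesis .
        qed (simp add: ennreal_neg)
      qed
      also have "conv_iter \<nu> (Suc k) (\<lambda>x. ennreal c * ennreal x) t = ennreal c * I"
        unfolding I_def by (subst conv_iter_cmult) auto
      also have "conv_iter \<nu> (Suc k) (\<lambda>x. W 1 x + ennreal d * heaviside x) t
          = W (Suc (Suc k)) t + ennreal d * W (Suc k) t"
        using power_W by (subst conv_iter_add) (auto simp: conv_iter_cmult simp del: funpow.simps)
      also have "\<dots> = ennreal (v (Suc (Suc k)) t + d * ?w)"
        using c by (simp add: ennreal_v[symmetric] ennreal_plus ennreal_mult v_nonneg del: funpow.simps ls_conv_power.simps)
      also have "ennreal c * I = ennreal (c * i)" using i c by (simp add: ennreal_mult)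
      finally show ?thesis
        using c by (subst (asm) ennreal_le_iff) (auto intro!: mult_nonneg_nonneg add_nonneg_nonneg v_nonneg
            simp del: ls_conv_power.simps)
    qed
    let ?n = "real (Suc k)"
    have "?n * (\<delta> * e) \<le> ?n * (i + \<delta> * R0 * ?w)"
      by (intro mult_left_mono 2) simp
    moreover have "\<delta> * (t * ?w) = \<delta> * i + ?n * (\<delta> * e)" unfolding 1 by (simp add: algebra_simps)
    moreover have "\<delta> * i \<le> ?n * (\<delta> * i)" using mult_right_mono[of 1 ?n "\<delta> * i"] \<delta> i by simp
    ultimately have "\<delta> * (t * ?w) \<le> ?n * ((1 + \<delta>) * i + \<delta> * R0 * ?w)"
      by (simp add: algebra_simps)
    then have "\<delta> * (t / ?n * ?w) \<le> (1 + \<delta>) * i + \<delta> * R0 * ?w"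
      by (simp add: field_simps del: of_nat_Suc)
    then have "\<delta> * ((t / ?n - R0) * ?w) \<le> i * (1 + \<delta>)"
      by (simp only: left_diff_distrib right_diff_distrib distrib_left distrib_right mult.assoc mult_1 mult_1_right
          mult.commute[of i \<delta>] diff_le_eq)
    then have "\<delta> * ((t / ?n - R0) * ?w) / (1 + \<delta>) \<le> i"
      using \<delta> by (subst pos_divide_le_eq) auto
    then have "\<kappa> * ((t / ?n - R0) * ?w) \<le> i" by (simp add: \<kappa>_def)
    then have "c * (\<kappa> * ((t / ?n - R0) * ?w)) \<le> c * i" using c by (intro mult_left_mono) auto
    with 3 show ?thesis by (simp add: algebra_simps)
  qed
  \<comment> \<open>With the larger denominator \<open>n + 1\<close> the bound also makes sense, and holds, for \<open>n = 0\<close>.\<close>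
  have main: "(c * \<kappa> * t / real (Suc n) - (c * \<kappa> * R0 + d)) * v n t \<le> v (Suc n) t" if "t \<ge> 0" for n t
  proof (cases n)
    case 0
    have "c * \<kappa> * t \<le> c * t"
      using c \<kappa> that by (intro mult_right_mono) (auto simp: mult_le_cancel_left1 field_simps)
    moreover have "c * t \<le> V t + d" by (rule c)
    moreover have "0 \<le> c * \<kappa> * R0" using c \<kappa> \<delta> by simp
    ultimately show ?thesis using 0 that by simp
  next
    case (Suc k)
    have "c * \<kappa> * t / real (Suc n) \<le> c * \<kappa> * (t / real (Suc k))"
      using c \<kappa> that Suc by (simp add: field_simps)
    then have "c * \<kappa> * t / real (Suc n) - (c * \<kappa> * R0 + d) \<le> c * \<kappa> * (t / real (Suc k) - R0) - d"
      by (simp add: algebra_simps)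
    then have "(c * \<kappa> * t / real (Suc n) - (c * \<kappa> * R0 + d)) * v n t
        \<le> (c * \<kappa> * (t / real (Suc k) - R0) - d) * v n t"
      by (intro mult_right_mono v_nonneg)
    also have "\<dots> \<le> v (Suc n) t" using succ[OF that, of k] Suc by simp
    finally show ?thesis .
  qed
  show ?thesis
    by (rule that[OF _ main]) (use c \<kappa> in auto)
qed

end

section \<open>Increments of growing convolution powers\<close>

context blackwell_function
begin

lemma power_ratio_at_top:
  assumes j: "(\<lambda>t. real (j t)) \<in> o[at_top](\<lambda>t. t)" and "s \<ge> 0"
  shows "eventually (\<lambda>t. \<forall>n\<le>j t. K * v n (t + s) \<le> v (Suc n) (t + s)) at_top"
proof -
  obtain \<alpha> \<beta> where \<alpha>\<beta>: "\<alpha> > 0" "\<And>n t. t \<ge> 0 \<Longrightarrow> (\<alpha> * t / real (Suc n) - \<beta>) * v n t \<le> v (Suc n) t"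
    by (rule power_ratio) blast
  define L where "L = max 1 (K + \<beta>)"
  have L: "L > 0" "K + \<beta> \<le> L" by (auto simp: L_def)
  have "eventually (\<lambda>t. norm (real (j t)) \<le> \<alpha> / (2 * L) * norm t) at_top"
    using \<alpha>\<beta>(1) L by (intro landau_o.smallD[OF j]) auto
  then show ?thesis
    using eventually_ge_at_top[of "2 * L / \<alpha>"] eventually_ge_at_top[of 0]
  proof eventually_elim
    case (elim t)
    show ?case
    proof (intro allI impI)
      fix n assume "n \<le> j t"
      have "L * real n \<le> L * real (j t)" using \<open>n \<le> j t\<close> L by (intro mult_left_mono) auto
      moreover have "L * real (j t) \<le> \<alpha> * t / 2" using elim L by (simp add: field_simps)
      moreover have "L \<le> \<alpha> * t / 2" using elim \<alpha>\<beta>(1) by (simp add: field_simps)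
      ultimately have "L * real (Suc n) \<le> \<alpha> * t" by (simp add: algebra_simps)
      also have "\<dots> \<le> \<alpha> * (t + s)" using \<alpha>\<beta>(1) \<open>s \<ge> 0\<close> by simp
      finally have "L * real (Suc n) \<le> \<alpha> * (t + s)" .
      have "K \<le> \<alpha> * (t + s) / real (Suc n) - \<beta>"
      proof -
        have "(K + \<beta>) * real (Suc n) \<le> L * real (Suc n)" using L by (intro mult_right_mono) auto
        also have "\<dots> \<le> \<alpha> * (t + s)" by fact
        finally have "K + \<beta> \<le> \<alpha> * (t + s) / real (Suc n)"
          by (subst pos_le_divide_eq) auto
        then show ?thesis by simp
      qed
      then have "K * v n (t + s) \<le> (\<alpha> * (t + s) / real (Suc n) - \<beta>) * v n (t + s)"
        by (intro mult_right_mono v_nonneg)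
      also have "\<dots> \<le> v (Suc n) (t + s)" using elim \<open>s \<ge> 0\<close> by (intro \<alpha>\<beta>) auto
      finally show "K * v n (t + s) \<le> v (Suc n) (t + s)" .
    qed
  qed
qed

lemma power_pos:
  assumes j: "(\<lambda>t. real (j t)) \<in> o[at_top](\<lambda>t. t)"
  shows "eventually (\<lambda>t. 0 < v (j t) t) at_top"
  using power_ratio_at_top[OF j order_refl, of 1] eventually_ge_at_top[of 0]
proof eventually_elim
  case (elim t)
  have "0 < v n t" if "n \<le> j t" for n
    using that
  proof (induction n)
    case 0
    then show ?case using elim by simp
  next
    case (Suc n)
    then show ?case using elim(1)[rule_format, of n] by (simp add: less_le_trans)
  qed
  then show ?case by blast
qed

text \<open>Bounded increments of one factor bound an increment of \<open>V_{n+1}\<close> by a multiple of \<open>V_n\<close>,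
  which is negligible against \<open>V_{n+1}\<close> itself.\<close>

lemma power_shift_forward:
  assumes j: "(\<lambda>t. real (j t)) \<in> o[at_top](\<lambda>t. t)" and "s \<ge> 0" "\<epsilon> > 0"
  shows "eventually (\<lambda>t. v (j t) (t + s) \<le> (1 + \<epsilon>) * v (j t) t) at_top"
proof -
  obtain C where C: "C > 0" "\<And>x. V (x + s) \<le> V x + C"
    by (rule increment_bounded_pos) blast
  have lift: "v (Suc n) (t + s) \<le> v (Suc n) t + C * v n (t + s)" for n t
  proof -
    have "1 * v 1 (x + s) + 0 * v 0 (x + 0) \<le> 1 * v 1 (x + 0) + C * v 0 (x + s) + 0 * v 0 (x + 0)" for x
      using C(2)[of x] V_neg[of "x + s"] V_nonneg[of x] by (auto split: split_indicator)
    from lift_inequality[OF _ _ _ _ _ this, where n = n and t = t] C(1) show ?thesis by simp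
  qed
  \<comment> \<open>With this ratio, \<open>C * v n (t + s)\<close> is at most the fraction \<open>\<epsilon> / (1 + \<epsilon>)\<close> of
     \<open>v (Suc n) (t + s)\<close>.\<close>
  define K where "K = C * (1 + \<epsilon>) / \<epsilon>"
  show ?thesis
    using power_ratio_at_top[OF j \<open>s \<ge> 0\<close>, of K] eventually_ge_at_top[of 0]
  proof eventually_elim
    case (elim t)
    show ?case
    proof (cases "j t")
      case 0
      then show ?thesis using elim \<open>s \<ge> 0\<close> \<open>\<epsilon> > 0\<close> by simp
    next
      case (Suc n)
      have "K * v n (t + s) \<le> v (Suc n) (t + s)" using elim Suc by simp
      then have "\<epsilon> * (K * v n (t + s)) \<le> \<epsilon> * v (Suc n) (t + s)"
        using \<open>\<epsilon> > 0\<close> by (intro mult_left_mono) auto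
      then have "C * (1 + \<epsilon>) * v n (t + s) \<le> \<epsilon> * v (Suc n) (t + s)"
        using \<open>\<epsilon> > 0\<close> by (simp add: K_def del: ls_conv_power.simps)
      moreover have "(1 + \<epsilon>) * v (Suc n) (t + s) \<le> (1 + \<epsilon>) * (v (Suc n) t + C * v n (t + s))"
        using \<open>\<epsilon> > 0\<close> by (intro mult_left_mono lift) auto
      ultimately show ?thesis unfolding Suc by (simp add: algebra_simps del: ls_conv_power.simps)
    qed
  qed
qed

lemma smallo_shift:
  assumes j: "(\<lambda>t. real (j t)) \<in> o[at_top](\<lambda>t. t)"
  shows "(\<lambda>t. real (j (t + a))) \<in> o[at_top](\<lambda>t. t)"
proof -
  have "filterlim (\<lambda>t. a + t) at_top at_top"
    by (rule filterlim_tendsto_add_at_top[OF tendsto_const filterlim_ident])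
  then have "(\<lambda>t. real (j (a + t))) \<in> o[at_top](\<lambda>t. a + t)"
    by (rule landau_o.small.compose[OF j])
  moreover have "(\<lambda>t. a + t) \<in> O[at_top](\<lambda>t. t)"
  proof (rule landau_o.bigI[of 2])
    show "eventually (\<lambda>t. norm (a + t) \<le> 2 * norm t) at_top"
      using eventually_ge_at_top[of "\<bar>a\<bar>"] by eventually_elim auto
  qed simp
  ultimately show ?thesis
    by (simp add: add.commute landau_o.small_big_trans)
qed

text \<open>Substituting \<open>t - a\<close> for \<open>t\<close> in the forward estimate changes the index to \<open>j(t + a)\<close>,
  whose growth is of the same kind.\<close>

lemma power_shift_backward:
  assumes j: "(\<lambda>t. real (j t)) \<in> o[at_top](\<lambda>t. t)" and "a \<ge> 0" "\<epsilon> > 0"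
  shows "eventually (\<lambda>t. v (j t) t \<le> (1 + \<epsilon>) * v (j t) (t - a)) at_top"
proof -
  have "filterlim (\<lambda>t. - a + t) at_top at_top"
    by (rule filterlim_tendsto_add_at_top[OF tendsto_const filterlim_ident])
  from eventually_compose_filterlim[OF power_shift_forward[OF smallo_shift[OF j, of a] assms(2,3)] this]
  show ?thesis by simp
qed

text \<open>Write \<open>V_j(t + h) - V_j(t)\<close> as the \<open>(j - 1)\<close>-fold convolution of the increment of \<open>V\<close>. That
  increment is close to \<open>h/m\<close> beyond some \<open>a\<close> and bounded on the remaining window, whose
  contribution is negligible since \<open>V_{j-1}\<close> varies slowly.\<close>

theorem power_increment:
  assumes j: "(\<lambda>t. real (j t)) \<in> o[at_top](\<lambda>t. t)" and j_pos: "\<And>t. t \<ge> 0 \<Longrightarrow> j t \<ge> 1" and "h > 0"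
  shows "((\<lambda>t. (v (j t) (t + h) - v (j t) t) / (h / m * v (j t - 1) t)) \<longlongrightarrow> 1) at_top"
proof -
  define k where "k t = j t - 1" for t
  have k: "(\<lambda>t. real (k t)) \<in> o[at_top](\<lambda>t. t)"
  proof (rule landau_o.big_small_trans[OF _ j])
    show "(\<lambda>t. real (k t)) \<in> O(\<lambda>t. real (j t))"
      by (rule landau_o.bigI[of 1]) (auto simp: k_def)
  qed
  have hm: "h / m > 0" using \<open>h > 0\<close> m_pos by simp
  have "((\<lambda>t. (v (j t) (t + h) - v (j t) t) / v (k t) t) \<longlongrightarrow> h / m) at_top"
  proof (rule tendstoI)
    fix \<epsilon> :: real assume "\<epsilon> > 0"
    obtain C where C: "C > 0" "\<And>x. V (x + h) \<le> V x + C"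
      by (rule increment_bounded_pos) blast
    \<comment> \<open>\<open>\<epsilon>1\<close> is the error in Blackwell's theorem, \<open>\<epsilon>2\<close> the relative variation of the power over
       the window from \<open>t - a\<close> to \<open>t + h\<close>; each of the three error terms is at most \<open>\<epsilon> / 3\<close>.\<close>
    define \<epsilon>1 where "\<epsilon>1 = min (h / m) (\<epsilon> / 3)"
    define \<epsilon>2 where "\<epsilon>2 = min (\<epsilon> / (6 * C)) (min (\<epsilon> / (3 * (h / m))) 1)"
    have \<epsilon>1: "\<epsilon>1 > 0" "\<epsilon>1 \<le> h / m" "\<epsilon>1 \<le> \<epsilon> / 3"
      unfolding \<epsilon>1_def by (rule min.cobounded1 min.cobounded2 | use \<open>\<epsilon> > 0\<close> hm in simp)+
    have \<epsilon>2: "\<epsilon>2 > 0" "\<epsilon>2 \<le> 1" "\<epsilon>2 * C \<le> \<epsilon> / 6" "\<epsilon>2 * (h / m) \<le> \<epsilon> / 3"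
    proof -
      have "0 < \<epsilon> / (6 * C)" "0 < \<epsilon> / (3 * (h / m))"
        using \<open>\<epsilon> > 0\<close> \<open>h > 0\<close> m_pos C by simp_all
      then show "\<epsilon>2 > 0" "\<epsilon>2 \<le> 1" by (simp_all add: \<epsilon>2_def del: divide_divide_eq_right times_divide_eq_right)
      have "\<epsilon>2 \<le> \<epsilon> / (6 * C)" "\<epsilon>2 \<le> \<epsilon> / (3 * (h / m))" by (auto simp: \<epsilon>2_def)
      then show "\<epsilon>2 * C \<le> \<epsilon> / 6" "\<epsilon>2 * (h / m) \<le> \<epsilon> / 3" using C \<open>h > 0\<close> m_pos by (auto simp: field_simps)
    qed
    have "eventually (\<lambda>x. dist (V (x + h) - V x) (h / m) < \<epsilon>1) at_top"
      using increment_limit[OF \<open>h > 0\<close>] \<epsilon>1 by (intro tendstoD)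
    then obtain a0 where a0: "\<And>x. x \<ge> a0 \<Longrightarrow> dist (V (x + h) - V x) (h / m) < \<epsilon>1"
      by (auto simp: eventually_at_top_linorder)
    define a where "a = max 0 a0"
    have a: "a \<ge> 0" "\<And>x. x \<ge> a \<Longrightarrow> V (x + h) \<le> V x + (h / m + \<epsilon>1)"
      "\<And>x. x \<ge> a \<Longrightarrow> V x + (h / m - \<epsilon>1) \<le> V (x + h)"
    proof -
      show "a \<ge> 0" by (simp add: a_def)
      fix x assume "x \<ge> a"
      then have "\<bar>V (x + h) - V x - h / m\<bar> < \<epsilon>1" using a0[of x] by (simp add: a_def dist_real_def)
      then show "V (x + h) \<le> V x + (h / m + \<epsilon>1)" "V x + (h / m - \<epsilon>1) \<le> V (x + h)" by linarith+
    qed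
    have upper: "v (Suc n) (t + h) + C * v n (t - a)
        \<le> v (Suc n) t + (h / m + \<epsilon>1) * v n t + C * v n (t + h)" for n t
    proof -
      have "1 * v 1 (x + h) + C * v 0 (x + - a)
          \<le> 1 * v 1 (x + 0) + (h / m + \<epsilon>1) * v 0 (x + 0) + C * v 0 (x + h)" for x
        using a(1) a(2)[of x] C(2)[of x] C(1) V_neg[of "x + h"] V_nonneg[of x] hm \<epsilon>1 \<open>h > 0\<close>
        by (auto split: split_indicator)
      from lift_inequality[OF _ _ _ _ _ this, where n = n and t = t] C(1) hm \<epsilon>1 show ?thesis by simp
    qed
    have lower: "v (Suc n) t + (h / m - \<epsilon>1) * v n (t - a) \<le> v (Suc n) (t + h)" for n t
    proof -
      have "1 * v 1 (x + 0) + (h / m - \<epsilon>1) * v 0 (x + - a)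
          \<le> 1 * v 1 (x + h) + 0 * v 0 (x + 0) + 0 * v 0 (x + 0)" for x
        using a(3)[of x] V_mono[of x "x + h"] \<open>h > 0\<close> by (auto split: split_indicator)
      from lift_inequality[OF _ _ _ _ _ this, where n = n and t = t] \<epsilon>1 show ?thesis by simp
    qed
    show "eventually (\<lambda>t. dist ((v (j t) (t + h) - v (j t) t) / v (k t) t) (h / m) < \<epsilon>) at_top"
      using power_shift_forward[OF k less_imp_le[OF \<open>h > 0\<close>] \<epsilon>2(1)]
        power_shift_backward[OF k a(1) \<epsilon>2(1)] power_pos[OF k] eventually_ge_at_top[of 0]
    proof eventually_elim
      case (elim t)
      define w where "w = v (k t) t"
      define w' where "w' = v (k t) (t - a)"
      define D where "D = v (j t) (t + h) - v (j t) t"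
      have jk: "j t = Suc (k t)" using j_pos[OF elim(4)] by (simp add: k_def)
      have w: "w > 0" using elim by (simp add: w_def)
      have w': "w - \<epsilon>2 * w \<le> w'" "w' \<le> w"
      proof -
        show "w' \<le> w" unfolding w_def w'_def using a(1) by (intro v_mono) simp
        then have "\<epsilon>2 * w' \<le> \<epsilon>2 * w" using \<epsilon>2 by (intro mult_left_mono) auto
        then show "w - \<epsilon>2 * w \<le> w'" using elim(2) by (simp add: w_def w'_def algebra_simps)
      qed
      have "D \<le> (h / m + \<epsilon>1) * w + C * (v (k t) (t + h) - w')"
        using upper[of "k t" t] by (simp add: D_def jk w_def w'_def algebra_simps del: ls_conv_power.simps)
      also have "C * (v (k t) (t + h) - w') \<le> C * (2 * \<epsilon>2 * w)"
        using elim(1) w' C(1) by (intro mult_left_mono) (auto simp: w_def algebra_simps)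
      also have "C * (2 * \<epsilon>2 * w) = 2 * (\<epsilon>2 * C) * w" by simp
      also have "\<dots> \<le> 2 * (\<epsilon> / 6) * w" using \<epsilon>2(3) w by (intro mult_right_mono mult_left_mono) auto
      finally have "D \<le> (h / m + \<epsilon>1 + \<epsilon> / 3) * w" by (simp add: algebra_simps)
      also have "\<dots> < (h / m + \<epsilon>) * w" using \<epsilon>1 \<open>\<epsilon> > 0\<close> w by (intro mult_strict_right_mono) auto
      finally have D_upper: "D / w < h / m + \<epsilon>" using w by (simp add: field_simps)
      have "(h / m - \<epsilon>) * w < (h / m - \<epsilon>1 - \<epsilon> / 3) * w"
        using \<epsilon>1 \<open>\<epsilon> > 0\<close> w by (intro mult_strict_right_mono) auto
      also have "\<dots> \<le> (h / m - \<epsilon>1 - \<epsilon>2 * (h / m - \<epsilon>1)) * w"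
      proof (intro mult_right_mono)
        have "\<epsilon>2 * (h / m - \<epsilon>1) \<le> \<epsilon>2 * (h / m)" using \<epsilon>1 \<epsilon>2 by (intro mult_left_mono) auto
        then show "h / m - \<epsilon>1 - \<epsilon> / 3 \<le> h / m - \<epsilon>1 - \<epsilon>2 * (h / m - \<epsilon>1)" using \<epsilon>2(4) by linarith
      qed (use w in simp)
      also have "\<dots> = (h / m - \<epsilon>1) * (w - \<epsilon>2 * w)" by (simp add: algebra_simps)
      also have "\<dots> \<le> (h / m - \<epsilon>1) * w'" using w' \<epsilon>1 by (intro mult_left_mono) auto
      also have "\<dots> \<le> D"
        using lower[of "k t" t] by (simp add: D_def jk w'_def del: ls_conv_power.simps)
      finally have D_lower: "h / m - \<epsilon> < D / w" using w by (simp add: field_simps)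
      show ?case using D_upper D_lower by (simp add: dist_real_def D_def w_def abs_less_iff)
    qed
  qed
  then have "((\<lambda>t. (v (j t) (t + h) - v (j t) t) / v (k t) t / (h / m)) \<longlongrightarrow> (h / m) / (h / m)) at_top"
    by (rule tendsto_divide[OF _ tendsto_const]) (use \<open>h > 0\<close> m_pos in simp)
  then show ?thesis using \<open>h > 0\<close> m_pos by (simp add: k_def mult.commute)
qed

end

section \<open>The laws of the perturbed random walk\<close>

lemma (in prob_space) nn_integral_indep_sum:
  fixes X Y :: "'a \<Rightarrow> real"
  assumes ind: "indep_var borel X borel Y" and [measurable]: "f \<in> borel_measurable borel"
  shows "(\<integral>\<^sup>+\<omega>. f (t - (X \<omega> + Y \<omega>)) \<partial>M) = (distr M borel X \<odot> (distr M borel Y \<odot> f)) t"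
proof -
  have [measurable]: "random_variable borel X" "random_variable borel Y"
    using ind by (auto dest: indep_var_rv1 indep_var_rv2)
  interpret X: prob_space "distr M borel X" by (rule prob_space_distr) simp
  interpret Y: prob_space "distr M borel Y" by (rule prob_space_distr) simp
  have "(\<integral>\<^sup>+\<omega>. f (t - (X \<omega> + Y \<omega>)) \<partial>M) = (\<integral>\<^sup>+x. f (t - x) \<partial>distr M borel (\<lambda>\<omega>. X \<omega> + Y \<omega>))"
    by (simp add: nn_integral_distr)
  also have "\<dots> = (\<integral>\<^sup>+x. \<integral>\<^sup>+y. f (t - (x + y)) \<partial>distr M borel Y \<partial>distr M borel X)"
    unfolding sum_indep_random_variable[OF ind \<open>random_variable borel X\<close> \<open>random_variable borel Y\<close>]
    by (rule nn_integral_convolution[where f = "\<lambda>x. f (t - x)"]) (auto intro: X.finite_measure_axioms Y.finite_measure_axioms)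
  finally show ?thesis by (simp add: conv_fun_def diff_diff_eq)
qed

locale perturbed_walk = prob_space M for M :: "'a measure" +
  fixes \<xi> \<eta> :: "'a \<Rightarrow> real" and \<xi>s \<eta>s :: "nat \<Rightarrow> 'a \<Rightarrow> real"
  assumes \<xi>_meas [measurable]: "\<xi> \<in> borel_measurable M" and \<eta>_meas [measurable]: "\<eta> \<in> borel_measurable M"
    and \<xi>_pos: "AE \<omega> in M. \<xi> \<omega> > 0" and \<eta>_pos: "AE \<omega> in M. \<eta> \<omega> > 0"
    and indep: "indep_vars (\<lambda>_. borel) (\<lambda>i \<omega>. (\<xi>s i \<omega>, \<eta>s i \<omega>)) {1..}"
    and identical: "\<And>i. i \<ge> 1 \<Longrightarrow> distr M borel (\<lambda>\<omega>. (\<xi>s i \<omega>, \<eta>s i \<omega>)) = distr M borel (\<lambda>\<omega>. (\<xi> \<omega>, \<eta> \<omega>))"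
begin

abbreviation \<mu> :: "real measure" where "\<mu> \<equiv> distr M borel \<xi>"
abbreviation \<gamma> :: "real measure" where "\<gamma> \<equiv> distr M borel \<eta>"

sublocale law: perturbed_renewal \<mu> \<gamma>
proof -
  interpret \<mu>: prob_space \<mu> by (rule prob_space_distr) simp
  interpret \<gamma>: prob_space \<gamma> by (rule prob_space_distr) simp
  show "perturbed_renewal \<mu> \<gamma>"
  proof
    show "AE y in \<mu>. 0 < y" using \<xi>_pos by (simp add: AE_distr_iff)
    show "AE y in \<gamma>. 0 \<le> y" using \<eta>_pos by (simp add: AE_distr_iff) (auto elim: AE_mp)
  qed auto
qed

lemma pair_measurable: "i \<ge> 1 \<Longrightarrow> (\<lambda>\<omega>. (\<xi>s i \<omega>, \<eta>s i \<omega>)) \<in> measurable M borel"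
  using indep unfolding indep_vars_def by auto

lemma fst_borel: "fst \<in> borel_measurable (borel :: (real \<times> real) measure)"
  and snd_borel: "snd \<in> borel_measurable (borel :: (real \<times> real) measure)"
  by (auto intro!: borel_measurable_continuous_onI continuous_intros)

lemma \<xi>s_measurable: "i \<ge> 1 \<Longrightarrow> \<xi>s i \<in> borel_measurable M"
  using measurable_compose[OF pair_measurable fst_borel, of i] by simp

lemma \<eta>s_measurable: "i \<ge> 1 \<Longrightarrow> \<eta>s i \<in> borel_measurable M"
  using measurable_compose[OF pair_measurable snd_borel, of i] by simp

lemma law_\<xi>s: "i \<ge> 1 \<Longrightarrow> distr M borel (\<xi>s i) = \<mu>"
  using arg_cong[OF identical, of i "\<lambda>N. distr N borel fst"]
  by (simp add: distr_distr[OF fst_borel] pair_measurable o_def)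

lemma law_\<eta>s: "i \<ge> 1 \<Longrightarrow> distr M borel (\<eta>s i) = \<gamma>"
  using arg_cong[OF identical, of i "\<lambda>N. distr N borel snd"]
  by (simp add: distr_distr[OF snd_borel] pair_measurable o_def)

lemma rw_measurable [measurable]: "rw \<xi>s i \<in> borel_measurable M"
  unfolding rw_def by (intro borel_measurable_sum \<xi>s_measurable) auto

text \<open>Although \<open>\<xi>_i\<close> and \<open>\<eta>_i\<close> may depend on each other, the point \<open>T_{i+1}\<close> combines
  \<open>\<eta>_{i+1}\<close> with earlier steps only. Selecting the first component of the pairs up to \<open>i\<close> and the
  second one of the next pair yields an independent family.\<close>

lemma indep_next:
  "indep_var borel (\<xi>s (Suc i)) borel (rw \<xi>s i)" "indep_var borel (\<eta>s (Suc i)) borel (rw \<xi>s i)"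
proof -
  have *: "indep_vars (\<lambda>_. borel) (\<lambda>k \<omega>. g k (\<xi>s k \<omega>, \<eta>s k \<omega>)) (insert (Suc i) {1..i})"
    if "\<And>k. g k \<in> borel_measurable borel" for g :: "nat \<Rightarrow> real \<times> real \<Rightarrow> real"
    by (rule indep_vars_compose2[OF indep_vars_subset[OF indep]]) (use that in auto)
  have "indep_vars (\<lambda>_. borel) (\<lambda>k \<omega>. fst (\<xi>s k \<omega>, \<eta>s k \<omega>)) (insert (Suc i) {1..i})"
    by (rule *) (rule fst_borel)
  from indep_vars_sum[OF _ _ this]
  show "indep_var borel (\<xi>s (Suc i)) borel (rw \<xi>s i)" by (simp add: rw_def[abs_def])
  have "indep_vars (\<lambda>_. borel) (\<lambda>k \<omega>. (if k = Suc i then snd else fst) (\<xi>s k \<omega>, \<eta>s k \<omega>)) (insert (Suc i) {1..i})"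
    by (rule *) (auto simp: fst_borel snd_borel)
  from indep_vars_sum[OF _ _ this]
  have "indep_var borel (\<eta>s (Suc i)) borel (\<lambda>\<omega>. \<Sum>k\<in>{1..i}. (if k = Suc i then snd else fst) (\<xi>s k \<omega>, \<eta>s k \<omega>))"
    by simp
  also have "(\<lambda>\<omega>. \<Sum>k\<in>{1..i}. (if k = Suc i then snd else fst) (\<xi>s k \<omega>, \<eta>s k \<omega>)) = rw \<xi>s i"
    by (auto simp: rw_def fun_eq_iff intro!: sum.cong)
  finally show "indep_var borel (\<eta>s (Suc i)) borel (rw \<xi>s i)" .
qed

lemma nn_integral_rw:
  assumes [measurable]: "f \<in> borel_measurable borel"
  shows "(\<integral>\<^sup>+\<omega>. f (t - rw \<xi>s i \<omega>) \<partial>M) = conv_iter \<mu> i f t"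
proof (induction i arbitrary: t)
  case 0
  show ?case by (simp add: rw_def emeasure_space_1)
next
  case (Suc i)
  have "(\<integral>\<^sup>+\<omega>. f (t - rw \<xi>s (Suc i) \<omega>) \<partial>M) = (\<integral>\<^sup>+\<omega>. f (t - (\<xi>s (Suc i) \<omega> + rw \<xi>s i \<omega>)) \<partial>M)"
    by (simp add: rw_def add.commute)
  also have "\<dots> = (\<mu> \<odot> (distr M borel (rw \<xi>s i) \<odot> f)) t"
    using nn_integral_indep_sum[OF indep_next(1)] by (simp add: law_\<xi>s)
  also have "distr M borel (rw \<xi>s i) \<odot> f = conv_iter \<mu> i f"
    by (auto simp: fun_eq_iff conv_fun_def[of "distr M borel (rw \<xi>s i)"] nn_integral_distr Suc)
  finally show ?case by simp
qed

lemma nn_integral_prw: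
  assumes [measurable]: "f \<in> borel_measurable borel"
  shows "(\<integral>\<^sup>+\<omega>. f (t - prw \<xi>s \<eta>s (Suc i) \<omega>) \<partial>M) = conv_iter \<mu> i (\<gamma> \<odot> f) t"
proof -
  have "(\<integral>\<^sup>+\<omega>. f (t - prw \<xi>s \<eta>s (Suc i) \<omega>) \<partial>M) = (\<integral>\<^sup>+\<omega>. f (t - (\<eta>s (Suc i) \<omega> + rw \<xi>s i \<omega>)) \<partial>M)"
    by (simp add: prw_def add.commute)
  also have "\<dots> = (\<gamma> \<odot> (distr M borel (rw \<xi>s i) \<odot> f)) t"
    using nn_integral_indep_sum[OF indep_next(2)] by (simp add: law_\<eta>s)
  also have "distr M borel (rw \<xi>s i) \<odot> f = conv_iter \<mu> i f"
    by (auto simp: fun_eq_iff conv_fun_def[of "distr M borel (rw \<xi>s i)"] nn_integral_distr nn_integral_rw)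
  also have "\<gamma> \<odot> conv_iter \<mu> i f = conv_iter \<mu> i (\<gamma> \<odot> f)"
    by (rule conv_iter_commute[OF law.sigma_finite_borel_axioms law.noise.sigma_finite_borel_axioms]) simp
  finally show ?thesis .
qed

lemma prw_measurable [measurable]: "prw \<xi>s \<eta>s (Suc i) \<in> borel_measurable M"
  unfolding prw_def[abs_def] using \<eta>s_measurable[of "Suc i"] by simp

lemma prob_prw_le:
  "conv_iter \<mu> i (\<gamma> \<odot> heaviside) t = ennreal (cdf (distr M borel (prw \<xi>s \<eta>s (Suc i))) t)"
proof -
  have "conv_iter \<mu> i (\<gamma> \<odot> heaviside) t = (\<integral>\<^sup>+\<omega>. heaviside (t - prw \<xi>s \<eta>s (Suc i) \<omega>) \<partial>M)"
    by (rule nn_integral_prw[symmetric]) simp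
  also have "\<dots> = (\<integral>\<^sup>+x. indicator {..t} x \<partial>distr M borel (prw \<xi>s \<eta>s (Suc i)))"
    by (subst nn_integral_distr) (auto intro!: nn_integral_cong split: split_indicator)
  also have "\<dots> = ennreal (cdf (distr M borel (prw \<xi>s \<eta>s (Suc i))) t)"
    by (simp add: cdf_def measure_def emeasure_distr ennreal_enn2real_if)
  finally show ?thesis .
qed

lemma prw_V_eq_renewal: "prw_V M \<xi>s \<eta>s t = enn2real (renewal \<mu> (\<gamma> \<odot> heaviside) t)"
proof (cases "t < 0")
  case True
  have "(\<gamma> \<odot> heaviside) x = 0" if "x \<le> t" for x
    using law.noise.conv_iter_eq_0[of x heaviside 1] that True by simp
  then have "renewal \<mu> (\<gamma> \<odot> heaviside) t = 0"
    unfolding renewal_def by (subst law.conv_iter_eq_0) auto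
  then show ?thesis using True by (simp add: prw_V_def)
next
  case False
  have "(\<integral>\<^sup>+\<omega>. prw_count \<xi>s \<eta>s t \<omega> \<partial>M) = (\<Sum>i. \<integral>\<^sup>+\<omega>. indicator {..t} (prw \<xi>s \<eta>s (Suc i) \<omega>) \<partial>M)"
    unfolding prw_count_def by (rule nn_integral_suminf) simp
  also have "\<dots> = (\<Sum>i. \<integral>\<^sup>+\<omega>. heaviside (t - prw \<xi>s \<eta>s (Suc i) \<omega>) \<partial>M)"
    by (intro suminf_cong nn_integral_cong) (auto split: split_indicator)
  also have "\<dots> = renewal \<mu> (\<gamma> \<odot> heaviside) t"
    by (simp add: nn_integral_prw renewal_def)
  finally show ?thesis using False by (simp add: prw_V_def)
qed

lemma prw_V_mono: "x \<le> y \<Longrightarrow> prw_V M \<xi>s \<eta>s x \<le> prw_V M \<xi>s \<eta>s y"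
  using law.counting_increment[of "y - x" x] by (simp add: prw_V_eq_renewal)

text \<open>The distribution functions of the points are right-continuous, and so is their sum, by
  dominated convergence for series.\<close>

lemma prw_V_right_cont: "continuous (at_right t) (prw_V M \<xi>s \<eta>s)"
proof -
  define F where "F i = cdf (distr M borel (prw \<xi>s \<eta>s (Suc i)))" for i
  have prob: "real_distribution (distr M borel (prw \<xi>s \<eta>s (Suc i)))" for i
    by (rule real_distribution_distr) simp
  have F_nonneg: "0 \<le> F i x" for i x by (simp add: F_def cdf_def)
  have F_cont: "continuous (at_right x) (F i)" for i x
    unfolding F_def
    by (rule finite_borel_measure.cdf_is_right_cont) (use prob in \<open>simp add: real_distribution.finite_borel_measure_M\<close>)
  have F_mono: "F i x \<le> F i y" if "x \<le> y" for i x y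
    unfolding F_def
    by (rule finite_borel_measure.cdf_nondecreasing[OF _ that]) (use prob in \<open>simp add: real_distribution.finite_borel_measure_M\<close>)
  have renewal_F: "renewal \<mu> (\<gamma> \<odot> heaviside) x = (\<Sum>i. ennreal (F i x))" for x
    by (simp add: renewal_def prob_prw_le F_def)
  have F_summable: "summable (\<lambda>i. F i x)" for x
    using F_nonneg law.counting_finite[of x] by (intro summable_suminf_not_top) (auto simp: renewal_F)
  have V_F: "prw_V M \<xi>s \<eta>s x = (\<Sum>i. F i x)" for x
    unfolding prw_V_eq_renewal renewal_F
    by (subst suminf_ennreal2[OF F_nonneg F_summable]) (simp add: suminf_nonneg F_nonneg F_summable)
  have "eventually (\<lambda>s. s < t + 1) (at_right t)"
    by (auto simp: eventually_at_right_field intro!: exI[of _ "t + 1"])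
  then have near: "eventually (\<lambda>s. s \<le> t + 1) (at_right t)" by eventually_elim simp
  have "((\<lambda>s. \<Sum>i. F i s) \<longlongrightarrow> (\<Sum>i. F i t)) (at_right t)"
  proof (rule tannerys_theorem[THEN conjunct2, THEN conjunct2])
    show "((\<lambda>s. F i s) \<longlongrightarrow> F i t) (at_right t)" for i
      using F_cont by (simp add: continuous_within)
    show "eventually (\<lambda>(i, s). norm (F i s) \<le> F i (t + 1)) (at_top \<times>\<^sub>F at_right t)"
      using eventually_prodI[OF eventually_True near, of sequentially]
      by (rule eventually_mono) (use F_nonneg F_mono in auto)
  qed (use F_summable in auto)
  moreover have "prw_V M \<xi>s \<eta>s = (\<lambda>x. \<Sum>i. F i x)" by (rule ext) (rule V_F)
  ultimately show ?thesis by (simp add: continuous_within)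
qed

end

section \<open>Hypotheses on the step law\<close>

text \<open>If the step law lives on a lattice, so do its convolution powers; a lattice is a Lebesgue
  null set, which rules out an absolutely continuous component.\<close>

lemma spread_out_imp_nonlattice:
  assumes "prob_space \<mu>" "sets \<mu> = sets borel" "spread_out \<mu>"
  shows "nonlattice \<mu>"
  unfolding nonlattice_def
proof
  assume "\<exists>d>0. AE x in \<mu>. x \<in> range (\<lambda>n::nat. d * real n)"
  then obtain d where d: "AE x in \<mu>. x \<in> range (\<lambda>n::nat. d * real n)" by blast
  define D where "D = range (\<lambda>n::nat. d * real n)"
  have D_add: "x + y \<in> D" if "x \<in> D" "y \<in> D" for x y
    using that unfolding D_def by (auto intro!: image_eqI[where x = "_ + _"] simp: algebra_simps)
  have D_borel [measurable]: "D \<in> sets borel"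
    unfolding D_def by (rule sets.countable) auto
  interpret \<mu>: prob_space \<mu> by fact
  have power: "prob_space (measure_conv_power \<mu> n) \<and> sets (measure_conv_power \<mu> n) = sets borel
      \<and> emeasure (measure_conv_power \<mu> n) (UNIV - D) = 0" for n
  proof (induction n)
    case 0
    have "0 \<in> D" unfolding D_def by (auto intro!: image_eqI[where x = 0])
    then show ?case by (auto intro!: prob_space_return simp: emeasure_return)
  next
    case (Suc n)
    let ?N = "measure_conv_power \<mu> n"
    interpret N: prob_space ?N using Suc by blast
    have sets_N: "sets ?N = sets borel" using Suc by blast
    have "AE y in ?N. y \<in> D"
      using Suc sets_eq_imp_space_eq[OF sets_N] by (intro AE_I[of _ _ "UNIV - D"]) auto
    have "emeasure (convolution \<mu> ?N) (UNIV - D) = (\<integral>\<^sup>+x. indicator (UNIV - D) x \<partial>convolution \<mu> ?N)"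
      by simp
    also have "\<dots> = (\<integral>\<^sup>+x. \<integral>\<^sup>+y. indicator (UNIV - D) (x + y) \<partial>?N \<partial>\<mu>)"
      by (rule nn_integral_convolution) (auto simp: assms(2) sets_N intro: \<mu>.finite_measure_axioms N.finite_measure_axioms)
    also have "\<dots> = (\<integral>\<^sup>+x. 0 \<partial>\<mu>)"
    proof (rule nn_integral_cong_AE, use d in eventually_elim)
      fix x assume "x \<in> range (\<lambda>n::nat. d * real n)"
      then have "x \<in> D" by (simp add: D_def)
      have "(\<integral>\<^sup>+y. indicator (UNIV - D) (x + y) \<partial>?N) = (\<integral>\<^sup>+y. 0 \<partial>?N)"
        by (rule nn_integral_cong_AE)
          (use \<open>AE y in ?N. y \<in> D\<close> in eventually_elim, use D_add[OF \<open>x \<in> D\<close>] in auto)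
      then show "(\<integral>\<^sup>+y. indicator (UNIV - D) (x + y) \<partial>?N) = 0" by simp
    qed
    finally have "emeasure (convolution \<mu> ?N) (UNIV - D) = 0" by simp
    moreover have "prob_space (convolution \<mu> ?N)"
    proof -
      interpret P: pair_prob_space \<mu> ?N ..
      have [measurable_cong]: "sets \<mu> = sets borel" "sets ?N = sets borel" by (fact assms(2) sets_N)+
      show ?thesis unfolding convolution_def by (rule P.prob_space_distr) measurable
    qed
    ultimately show ?case by simp
  qed
  from assms(3) obtain n \<alpha> \<sigma> Z where
    split: "sets \<alpha> = sets borel"
      "\<And>A. A \<in> sets borel \<Longrightarrow> emeasure (measure_conv_power \<mu> n) A = emeasure \<alpha> A + emeasure \<sigma> A"
    and ac: "absolutely_continuous lborel \<alpha>" and nontrivial: "emeasure \<alpha> UNIV \<noteq> 0"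
    unfolding spread_out_def has_ac_component_def by blast
  have "emeasure \<alpha> (UNIV - D) = 0"
    using split(2)[of "UNIV - D"] power[of n] by simp
  moreover have "D \<in> null_sets \<alpha>"
  proof -
    have "D \<in> null_sets lborel"
      unfolding D_def by (rule countable_imp_null_set_lborel) simp
    then show ?thesis using ac unfolding absolutely_continuous_def by blast
  qed
  then have "emeasure \<alpha> D = 0" by auto
  moreover have "emeasure \<alpha> UNIV = emeasure \<alpha> (UNIV - D) + emeasure \<alpha> D"
    by (subst plus_emeasure) (auto simp: split(1))
  ultimately show False using nontrivial by simp
qed

text \<open>The mean is the integral of the tail, which is eventually dominated by \<open>2 * b * x powr (- r)\<close>.\<close>

lemma (in renewal_law) integrable_of_tail:
  assumes "b > 0" "r > 1"
    and tail_asymp: "((\<lambda>t. measure \<mu> {t<..} / (b * t powr (- r))) \<longlongrightarrow> 1) at_top"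
  shows "integrable \<mu> (\<lambda>y. y)"
proof -
  have "eventually (\<lambda>t. measure \<mu> {t<..} / (b * t powr (- r)) < 2) at_top"
    using tail_asymp by (rule order_tendstoD) simp
  then obtain T0 where T0: "\<And>t. t \<ge> T0 \<Longrightarrow> measure \<mu> {t<..} / (b * t powr (- r)) < 2"
    by (auto simp: eventually_at_top_linorder)
  define T where "T = max 1 T0"
  have T: "T \<ge> 1" "\<And>t. t \<ge> T \<Longrightarrow> measure \<mu> {t<..} \<le> 2 * b * t powr (- r)"
  proof -
    show "T \<ge> 1" by (simp add: T_def)
    fix t assume "t \<ge> T"
    then have "t > 0" "measure \<mu> {t<..} / (b * t powr (- r)) < 2" using T0[of t] by (auto simp: T_def)
    then show "measure \<mu> {t<..} \<le> 2 * b * t powr (- r)" using \<open>b > 0\<close> by (simp add: pos_divide_less_eq)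
  qed
  have primitive: "- (2 * b / (r - 1)) * ((1 - r) * x powr (1 - r - 1)) = 2 * b * x powr (- r)" for x
    using \<open>r > 1\<close> by (simp add: field_simps)
  have "(\<integral>\<^sup>+x. ennreal (2 * b * x powr (- r)) * indicator {T..} x \<partial>lborel)
      = ennreal (0 - (- (2 * b / (r - 1)) * T powr (1 - r)))"
  proof (rule nn_integral_FTC_atLeast)
    show "((\<lambda>x. - (2 * b / (r - 1)) * x powr (1 - r)) \<longlongrightarrow> 0) at_top"
      using \<open>r > 1\<close> by (intro tendsto_mult_right_zero tendsto_neg_powr filterlim_ident) auto
    fix x assume "T \<le> x"
    then have "x > 0" using T by simp
    then show "((\<lambda>x. - (2 * b / (r - 1)) * x powr (1 - r)) has_real_derivative 2 * b * x powr (- r)) (at x)"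
      using DERIV_cmult[OF has_real_derivative_powr[OF \<open>x > 0\<close>, of "1 - r"], of "- (2 * b / (r - 1))"]
      by (simp only: primitive)
  qed (use \<open>b > 0\<close> in auto)
  then have fin: "(\<integral>\<^sup>+x. ennreal (2 * b * x powr (- r)) * indicator {T..} x \<partial>lborel) < \<infinity>"
    by simp
  have "(\<integral>\<^sup>+y. ennreal y \<partial>\<mu>) = (\<integral>\<^sup>+x. tail x \<partial>lborel)" by (rule nn_integral_tail[symmetric])
  also have "\<dots> \<le> (\<integral>\<^sup>+x. indicator {0..T} x + ennreal (2 * b * x powr (- r)) * indicator {T..} x \<partial>lborel)"
  proof (rule nn_integral_mono)
    fix x :: real
    show "tail x \<le> indicator {0..T} x + ennreal (2 * b * x powr (- r)) * indicator {T..} x"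
    proof (cases "x \<ge> T")
      case True
      have "tail x \<le> ennreal (2 * b * x powr (- r))"
        using T True by (auto simp: tail_def emeasure_eq_measure intro!: ennreal_leI split: split_indicator)
      then show ?thesis using True by (simp add: add_increasing)
    next
      case False
      then show ?thesis
        by (auto simp: tail_def intro: measure_le_1 split: split_indicator)
    qed
  qed
  also have "\<dots> = (\<integral>\<^sup>+x. indicator {0..T} x \<partial>lborel) + (\<integral>\<^sup>+x. ennreal (2 * b * x powr (- r)) * indicator {T..} x \<partial>lborel)"
    by (rule nn_integral_add) auto
  also have "\<dots> < \<infinity>" using fin T by simp
  finally have "(\<integral>\<^sup>+y. ennreal y \<partial>\<mu>) < \<infinity>" .
  moreover have "(\<integral>\<^sup>+y. ennreal (norm y) \<partial>\<mu>) = (\<integral>\<^sup>+y. ennreal y \<partial>\<mu>)"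
    by (rule nn_integral_cong_AE) (use AE_nonneg in eventually_elim, simp)
  ultimately have "(\<integral>\<^sup>+y. ennreal (norm y) \<partial>\<mu>) < \<infinity>" by simp
  then show ?thesis by (intro integrableI_bounded) auto
qed

text \<open>In either case the step law is nonlattice with finite mean, and \<open>j(t)\<close> is of smaller order
  than \<open>t\<close>.\<close>

theorem corollary2p8:
  fixes M :: "'a measure"
    and \<xi> \<eta> :: "'a \<Rightarrow> real"
    and \<xi>s \<eta>s :: "nat \<Rightarrow> 'a \<Rightarrow> real"
    and V :: "nat \<Rightarrow> real \<Rightarrow> real"
    and j :: "real \<Rightarrow> nat"
    and h m :: real
  assumes "prob_space M"
    and "\<xi> \<in> borel_measurable M" and "\<eta> \<in> borel_measurable M"
    and "AE \<omega> in M. \<xi> \<omega> > 0" and "AE \<omega> in M. \<eta> \<omega> > 0"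
    and "prob_space.indep_vars M (\<lambda>_. borel) (\<lambda>i \<omega>. (\<xi>s i \<omega>, \<eta>s i \<omega>)) {1..}"
    and "\<And>i. i \<ge> 1 \<Longrightarrow> distr M borel (\<lambda>\<omega>. (\<xi>s i \<omega>, \<eta>s i \<omega>)) = distr M borel (\<lambda>\<omega>. (\<xi> \<omega>, \<eta> \<omega>))"
    and "V = ls_conv_power (prw_V M \<xi>s \<eta>s)"
    and "h > 0"
    and "\<And>t. t \<ge> 0 \<Longrightarrow> j t \<ge> 1"
    and "m = (\<integral>\<omega>. \<xi> \<omega> \<partial>M)"
    and "(nonlattice (distr M borel \<xi>) \<and>
          (\<exists>r. ((r \<in> {1<..2} \<and> integrable M (\<lambda>\<omega>. \<xi> \<omega> powr r)) \<or>
                (r \<in> {1<..<2} \<and>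
                  (\<exists>b>0. ((\<lambda>t. measure M {\<omega> \<in> space M. \<xi> \<omega> > t} / (b * t powr (- r))) \<longlongrightarrow> 1) at_top))) \<and>
               (\<lambda>t. \<integral>\<omega>. min (\<eta> \<omega>) t \<partial>M) \<in> O[at_top](\<lambda>t. t powr (2 - r)) \<and>
               (\<lambda>t. real (j t)) \<in> o[at_top](\<lambda>t. t powr ((r - 1) / 2)))) \<or>
         (spread_out (distr M borel \<xi>) \<and>
          integrable M (\<lambda>\<omega>. \<xi> \<omega> ^ 3) \<and>
          integrable M (\<lambda>\<omega>. \<eta> \<omega> ^ 2) \<and>
          (\<lambda>t. real (j t)) \<in> o[at_top](\<lambda>t. t powr (2 / 3)))"
  shows "((\<lambda>t. (V (j t) (t + h) - V (j t) t) / (h / m * V (j t - 1) t)) \<longlongrightarrow> 1) at_top"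
proof -
  interpret perturbed_walk M \<xi> \<eta> \<xi>s \<eta>s
    using assms(2-7) by (intro perturbed_walk.intro perturbed_walk_axioms.intro assms(1))
  have j_linear: "(\<lambda>t. real (j t)) \<in> o[at_top](\<lambda>t. t)"
    if "(\<lambda>t. real (j t)) \<in> o[at_top](\<lambda>t. t powr p)" "p \<le> 1" for p
  proof (rule landau_o.small_big_trans[OF that(1)])
    show "(\<lambda>t. t powr p) \<in> O[at_top](\<lambda>t::real. t)"
    proof (rule landau_o.bigI[of 1])
      show "eventually (\<lambda>t::real. norm (t powr p) \<le> 1 * norm t) at_top"
        using eventually_ge_at_top[of 1]
      proof eventually_elim
        case (elim t)
        then show ?case using powr_mono[OF that(2), of t] by simp
      qed
    qed simp
  qed
  have integrable_power: "integrable M \<xi>"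
    if "integrable M (\<lambda>\<omega>. \<xi> \<omega> powr r)" "r \<ge> 1" for r
  proof (rule Bochner_Integration.integrable_bound)
    show "integrable M (\<lambda>\<omega>. 1 + \<xi> \<omega> powr r)" using that(1) by simp
    show "AE \<omega> in M. norm (\<xi> \<omega>) \<le> norm (1 + \<xi> \<omega> powr r)"
      using assms(4)
    proof eventually_elim
      case (elim \<omega>)
      show ?case
      proof (cases "\<xi> \<omega> \<le> 1")
        case False
        then have "\<xi> \<omega> powr 1 \<le> \<xi> \<omega> powr r" using that(2) by (intro powr_mono) auto
        then show ?thesis using False by simp
      qed (use elim in \<open>simp add: add_increasing2\<close>)
    qed
  qed (rule assms(2))
  have "nonlattice \<mu> \<and> integrable M \<xi> \<and> (\<lambda>t. real (j t)) \<in> o[at_top](\<lambda>t. t)"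
    using assms(12)
  proof (elim disjE conjE exE)
    fix r
    assume *: "nonlattice \<mu>" "(\<lambda>t. real (j t)) \<in> o(\<lambda>t. t powr ((r - 1) / 2))" "r \<in> {1<..2}"
      "integrable M (\<lambda>\<omega>. \<xi> \<omega> powr r)"
    then show ?thesis using integrable_power[of r] j_linear[OF *(2)] by simp
  next
    fix r b
    assume *: "nonlattice \<mu>" "(\<lambda>t. real (j t)) \<in> o(\<lambda>t. t powr ((r - 1) / 2))" "r \<in> {1<..<2}" "b > 0"
      and tail: "((\<lambda>t. measure M {\<omega> \<in> space M. \<xi> \<omega> > t} / (b * t powr (- r))) \<longlongrightarrow> 1) at_top"
    have "measure \<mu> {t<..} = measure M {\<omega> \<in> space M. \<xi> \<omega> > t}" for t
      by (simp add: measure_distr) (auto intro!: arg_cong[where f = "measure M"])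
    then have "integrable \<mu> (\<lambda>y. y)"
      using law.integrable_of_tail[of b r] * tail by simp
    then have "integrable M \<xi>" by (simp add: integrable_distr_eq)
    then show ?thesis using * j_linear[OF *(2)] by simp
  next
    assume *: "spread_out \<mu>" "integrable M (\<lambda>\<omega>. \<xi> \<omega> ^ 3)" "(\<lambda>t. real (j t)) \<in> o(\<lambda>t. t powr (2 / 3))"
    have "integrable M (\<lambda>\<omega>. \<xi> \<omega> powr 3)"
      by (rule integrable_cong_AE_imp[OF *(2)])
        (simp, use assms(4) in eventually_elim, simp add: powr_numeral)
    moreover have "nonlattice \<mu>"
      by (rule spread_out_imp_nonlattice) (use *(1) law.prob_space_axioms in auto)
    ultimately show ?thesis using integrable_power[of 3] j_linear[OF *(3)] by simp
  qed
  then have nonlattice: "nonlattice \<mu>" and integrable: "integrable M \<xi>"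
    and j: "(\<lambda>t. real (j t)) \<in> o[at_top](\<lambda>t. t)" by auto
  have integrable_law: "integrable \<mu> (\<lambda>y. y)"
    using integrable by (simp add: integrable_distr_eq)
  have m: "m = (\<integral>y. y \<partial>\<mu>)"
    unfolding assms(11) by (simp add: integral_distr)
  interpret counting: blackwell_function "prw_V M \<xi>s \<eta>s" m
  proof
    show "prw_V M \<xi>s \<eta>s x \<le> prw_V M \<xi>s \<eta>s y" if "x \<le> y" for x y
      by (rule prw_V_mono[OF that])
    show "continuous (at_right x) (prw_V M \<xi>s \<eta>s)" for x
      by (rule prw_V_right_cont)
    show "prw_V M \<xi>s \<eta>s x = 0" if "x < 0" for x
      using that by (simp add: prw_V_def)
    show "0 < m"
      unfolding m by (rule law.mean_pos[OF integrable_law])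
    show "\<exists>C. \<forall>x. prw_V M \<xi>s \<eta>s (x + s) \<le> prw_V M \<xi>s \<eta>s x + C" for s
    proof (cases "s \<ge> 0")
      case True
      then show ?thesis
        using law.counting_increment_bounded[of s] unfolding prw_V_eq_renewal by metis
    next
      case False
      then show ?thesis using prw_V_mono by (intro exI[of _ 0]) simp
    qed
    show "((\<lambda>x. prw_V M \<xi>s \<eta>s (x + s) - prw_V M \<xi>s \<eta>s x) \<longlongrightarrow> s / m) at_top" if "0 < s" for s
      unfolding prw_V_eq_renewal m
      by (rule law.counting_increment_limit[OF nonlattice integrable_law that])
  qed
  show ?thesis
    unfolding assms(8) by (rule counting.power_increment[OF j assms(10,9)])
qed

end
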